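(* Let $\mathbb{F}$ be an algebraically closed field with $\operatorname{char}(\mathbb{F})\neq 2$, and let $n$ be a positive integer. With the irreducible representations $\rho_i$ of each group numbered as in the tables of the context: A. For $G=D_4$ and $\rho=\bigoplus_{i=1}^{5}k_i\rho_i$ an $n$ degree representation, $\rho$ always has a non-degenerate invariant bilinear form. B. For $G=Q_8$ and $\rho=\bigoplus_{i=1}^{5}k_i\rho_i$ an $n$ degree representation, $\rho$ always has a non-degenerate invariant bilinear form. C. For $G=\mathbb{Z}_8$ and $\rho=\bigoplus_{i=1}^{8}k_i\rho_i$ an $n$ degree representation, $\rho$ has a non-degenerate invariant bilinear form if and only if $k_3=k_4$, $k_5=k_6$ and $k_7=k_8$. D. For $G=\mathbb{Z}_4\times\mathbb{Z}_2$ and $\rho=\bigoplus_{i=1}^{8}k_i\rho_i$ an $n$ degree representation, $\rho$ has a non-degenerate invariant bilinear form if and only if $k_5=k_6$ and $k_7=k_8$. E. For $G=\mathbb{Z}_2\times\mathbb{Z}_2\times\mathbb{Z}_2$ and $\rho=\bigoplus_{i=1}^{8}k_i\rho_i$ an $n$ degree representation, $\rho$ always has a non-degenerate invariant bilinear form.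
   Context: An $n$ degree representation of $G$ is a homomorphism $\rho:G\to GL(\mathbb{V})$ with $\mathbb{V}$ an $n$-dimensional $\mathbb{F}$-vector space. $k_i\rho_i$ denotes the direct sum of $k_i\ge 0$ copies of $\rho_i$. An invariant bilinear form for $\rho$ is a bilinear form $\mathbb{B}$ on $\mathbb{V}$ with $\mathbb{B}(\rho(g)x,\rho(g)y)=\mathbb{B}(x,y)$ for all $g\in G$, $x,y\in\mathbb{V}$. Let $\omega\in\mathbb{F}$ be a primitive eighth root of unity. The irreducible representations are: $D_4=\langle a,b\mid a^4=b^2=1,\ ba=a^3b\rangle$: $(\rho_i(a),\rho_i(b))$ is $(1,1),(1,-1),(-1,-1),(-1,1)$ for $i=1,2,3,4$, and $\rho_5(a)=\begin{bmatrix}0&-1\\1&0\end{bmatrix}$, $\rho_5(b)=\begin{bmatrix}1&0\\0&-1\end{bmatrix}$. $Q_8=\langle a,b\mid a^4=1,\ a^2=b^2,\ ba=a^3b\rangle$: $(\rho_i(a),\rho_i(b))$ is $(1,1),(1,-1),(-1,-1),(-1,1)$ for $i=1,2,3,4$, and $\rho_5(a)=\begin{bmatrix}\omega^2&0\\0&\omega^6\end{bmatrix}$, $\rho_5(b)=\begin{bmatrix}0&1\\-1&0\end{bmatrix}$. $\mathbb{Z}_8=\langle a\mid a^8=1\rangle$: $\rho_i(a)=1,\ \omega^4,\ \omega,\ \omega^7,\ \omega^2,\ \omega^6,\ \omega^3,\ \omega^5$ for $i=1,\dots,8$ respectively. $\mathbb{Z}_4\times\mathbb{Z}_2=\langle a,b\mid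 a^4=b^2=1,\ ab=ba\rangle$: $(\rho_i(a),\rho_i(b))$ is $(1,1),(1,-1),(-1,1),(-1,-1),(\omega^2,1),(\omega^6,1),(\omega^2,-1),(\omega^6,-1)$ for $i=1,\dots,8$ respectively. $\mathbb{Z}_2\times\mathbb{Z}_2\times\mathbb{Z}_2=\langle a,b,c\mid a^2=b^2=c^2=1,\ ab=ba,\ ac=ca,\ bc=cb\rangle$: $(\rho_i(a),\rho_i(b),\rho_i(c))$ is $(1,1,1),(-1,-1,-1),(1,-1,1),(1,-1,-1),(1,1,-1),(-1,-1,1),(-1,1,1),(-1,1,-1)$ for $i=1,\dots,8$ respectively. *)

theory Defs
  imports
    "HOL-Computational_Algebra.Computational_Algebra"
    "Jordan_Normal_Form.Matrix"
begin

section \<open>Groups given by generators and relations\<close>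

text \<open>The letter \<open>(i, True)\<close> is the generator number \<open>i\<close>, and \<open>(i, False)\<close> is its inverse.\<close>

type_synonym word = "(nat \<times> bool) list"

definition words :: "nat \<Rightarrow> word set" where
  "words m = lists ({..<m} \<times> UNIV)"

inductive word_eq :: "nat \<Rightarrow> (word \<times> word) set \<Rightarrow> word \<Rightarrow> word \<Rightarrow> bool" for m R where
  refl: "w \<in> words m \<Longrightarrow> word_eq m R w w"
| sym: "word_eq m R u v \<Longrightarrow> word_eq m R v u"
| trans: "word_eq m R u v \<Longrightarrow> word_eq m R v w \<Longrightarrow> word_eq m R u w"
| append: "word_eq m R u u' \<Longrightarrow> word_eq m R v v' \<Longrightarrow> word_eq m R (u @ v) (u' @ v')"
| cancel: "i < m \<Longrightarrow> word_eq m R [(i, e), (i, \<not> e)] []"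
| relation: "(u, v) \<in> R \<Longrightarrow> u \<in> words m \<Longrightarrow> v \<in> words m \<Longrightarrow> word_eq m R u v"

text \<open>The group on \<open>m\<close> generators with an equation \<open>u = v\<close> for every \<open>(u, v) \<in> R\<close>.\<close>

definition presented_group :: "nat \<Rightarrow> (word \<times> word) set \<Rightarrow> word set monoid" where
  "presented_group m R =
     \<lparr>carrier = words m // {(u, v). word_eq m R u v},
      monoid.mult = (\<lambda>X Y. \<Union>u\<in>X. \<Union>v\<in>Y. {w. word_eq m R (u @ v) w}),
      one = {w. word_eq m R [] w}\<rparr>"

definition generator :: "nat \<Rightarrow> (word \<times> word) set \<Rightarrow> nat \<Rightarrow> word set" where
  "generator m R i = {w. word_eq m R [(i, True)] w}"

definition word_value :: "('h, 'z) monoid_scheme \<Rightarrow> (nat \<Rightarrow> 'h) \<Rightarrow> word \<Rightarrow> 'h" where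
  "word_value H f w =
     foldr (\<lambda>(i, e) h. (if e then f i else inv\<^bsub>H\<^esub> (f i)) \<otimes>\<^bsub>H\<^esub> h) w \<one>\<^bsub>H\<^esub>"

text \<open>The homomorphism into \<open>H\<close> sending the generator number \<open>i\<close> to \<open>f i\<close>. It is meaningful only
  if the images satisfy the relations: the value then does not depend on the word chosen in the
  class (see \<open>induced_hom_in_hom\<close> and \<open>induced_hom_generator\<close> below).\<close>

definition induced_hom :: "('h, 'z) monoid_scheme \<Rightarrow> (nat \<Rightarrow> 'h) \<Rightarrow> word set \<Rightarrow> 'h" where
  "induced_hom H f X = word_value H f (SOME w. w \<in> X)"

lemma word_eq_words: "word_eq m R u v \<Longrightarrow> u \<in> words m \<and> v \<in> words m"
  by (induction rule: word_eq.induct) (auto simp: words_def)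

lemma equiv_word_eq: "equiv (words m) {(u, v). word_eq m R u v}"
  by (intro equivI refl_onI symI transI)
    (auto dest: word_eq_words word_eq.sym intro: word_eq.refl word_eq.trans)

lemma class_eq_iff:
  assumes "u \<in> words m" "v \<in> words m"
  shows "{w. word_eq m R u w} = {w. word_eq m R v w} \<longleftrightarrow> word_eq m R u v"
  using assms by (auto intro: word_eq.refl word_eq.trans word_eq.sym)

lemma carrier_presented_group:
  "carrier (presented_group m R) = (\<lambda>u. {w. word_eq m R u w}) ` words m"
  by (auto simp: presented_group_def quotient_def Image_def)

lemma mult_presented_group:
  assumes "u \<in> words m" "v \<in> words m"
  shows "{w. word_eq m R u w} \<otimes>\<^bsub>presented_group m R\<^esub> {w. word_eq m R v w} = {w. word_eq m R (u @ v) w}"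
proof -
  have "word_eq m R (u' @ v') w \<longleftrightarrow> word_eq m R (u @ v) w"
    if "word_eq m R u u'" "word_eq m R v v'" for u' v' w
    using that by (meson word_eq.append word_eq.sym word_eq.trans)
  then show ?thesis
    using assms by (auto simp: presented_group_def intro!: word_eq.refl)
qed

lemma word_inverse:
  assumes "u \<in> words m"
  shows "\<exists>v\<in>words m. word_eq m R (v @ u) []"
  using assms
proof (induction u)
  case Nil
  then show ?case by (auto simp: words_def intro!: bexI[of _ "[]"] word_eq.refl)
next
  case (Cons x u)
  obtain i e where x: "x = (i, e)" by (cases x)
  have i: "i < m" and u: "u \<in> words m" using Cons.prems x by (auto simp: words_def)
  obtain v where v: "v \<in> words m" "word_eq m R (v @ u) []" using Cons.IH u by blast
  have "word_eq m R ([(i, \<not> e), (i, e)] @ u) ([] @ u)"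
    using word_eq.cancel[OF i, of R "\<not> e"] word_eq.refl[OF u] by (intro word_eq.append) auto
  then have "word_eq m R (v @ [(i, \<not> e), (i, e)] @ u) (v @ u)"
    using word_eq.append[OF word_eq.refl[OF v(1)]] by fastforce
  then have "word_eq m R ((v @ [(i, \<not> e)]) @ x # u) []"
    using v(2) x by (auto intro: word_eq.trans)
  moreover have "v @ [(i, \<not> e)] \<in> words m" using v i by (auto simp: words_def)
  ultimately show ?case by blast
qed

lemma group_presented_group: "group (presented_group m R)"
proof -
  have one: "\<one>\<^bsub>presented_group m R\<^esub> = {w. word_eq m R [] w}" and nil: "[] \<in> words m"
    by (auto simp: presented_group_def words_def)
  have app: "u @ v \<in> words m" if "u \<in> words m" "v \<in> words m" for u v
    using that by (auto simp: words_def)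
  show ?thesis
  proof (rule groupI)
    fix X assume "X \<in> carrier (presented_group m R)"
    then obtain u where u: "u \<in> words m" "X = {w. word_eq m R u w}"
      by (auto simp: carrier_presented_group)
    obtain v where v: "v \<in> words m" "word_eq m R (v @ u) []" using word_inverse[OF u(1)] by blast
    have "{w. word_eq m R v w} \<otimes>\<^bsub>presented_group m R\<^esub> X = \<one>\<^bsub>presented_group m R\<^esub>"
      using u v nil app by (simp add: mult_presented_group one class_eq_iff)
    then show "\<exists>Y\<in>carrier (presented_group m R). Y \<otimes>\<^bsub>presented_group m R\<^esub> X = \<one>\<^bsub>presented_group m R\<^esub>"
      using v(1) by (auto simp: carrier_presented_group)
  qed (use nil in \<open>auto simp: carrier_presented_group mult_presented_group one app\<close>)
qed

lemma (in group) word_value_closed: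
  assumes "\<And>i. i < m \<Longrightarrow> f i \<in> carrier G" "w \<in> words m"
  shows "word_value G f w \<in> carrier G"
  using assms(2) by (induction w) (auto simp: word_value_def words_def assms(1))

lemma (in group) word_value_append:
  assumes "\<And>i. i < m \<Longrightarrow> f i \<in> carrier G" "u \<in> words m" "v \<in> words m"
  shows "word_value G f (u @ v) = word_value G f u \<otimes> word_value G f v"
  using assms(2)
proof (induction u)
  case Nil
  then show ?case using word_value_closed[OF assms(1,3)] by (simp add: word_value_def)
next
  case (Cons x u)
  then have u: "u \<in> words m" and x: "fst x < m" by (auto simp: words_def)
  have "word_value G f u \<in> carrier G" "word_value G f v \<in> carrier G"
    using word_value_closed[of m f] assms u by blast+
  then show ?case
    using Cons.IH[OF u] assms(1)[OF x] by (auto simp: word_value_def m_assoc split: prod.splits)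
qed

lemma (in group) word_value_cong:
  assumes "\<And>i. i < m \<Longrightarrow> f i \<in> carrier G"
    and "\<And>u v. (u, v) \<in> R \<Longrightarrow> word_value G f u = word_value G f v"
    and "word_eq m R u v"
  shows "word_value G f u = word_value G f v"
  using assms(3)
proof (induction rule: word_eq.induct)
  case (append u u' v v')
  then show ?case using word_eq_words word_value_append[of m f] assms(1) by metis
next
  case (cancel i e)
  then show ?case using assms(1)[of i] by (auto simp: word_value_def)
qed (auto simp: assms(2))

lemma (in group) induced_hom_class:
  assumes "\<And>i. i < m \<Longrightarrow> f i \<in> carrier G"
    and "\<And>u v. (u, v) \<in> R \<Longrightarrow> word_value G f u = word_value G f v"
    and "u \<in> words m"
  shows "induced_hom G f {w. word_eq m R u w} = word_value G f u"
proof -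
  have "word_eq m R u (SOME w. word_eq m R u w)"
    by (rule someI) (rule word_eq.refl[OF assms(3)])
  from word_value_cong[OF assms(1,2) this] show ?thesis
    by (simp add: induced_hom_def)
qed

lemma (in group) induced_hom_in_hom:
  assumes "\<And>i. i < m \<Longrightarrow> f i \<in> carrier G"
    and "\<And>u v. (u, v) \<in> R \<Longrightarrow> word_value G f u = word_value G f v"
  shows "induced_hom G f \<in> hom (presented_group m R) G"
proof (rule homI)
  fix X Y assume "X \<in> carrier (presented_group m R)" "Y \<in> carrier (presented_group m R)"
  then obtain u v where "u \<in> words m" "X = {w. word_eq m R u w}" "v \<in> words m" "Y = {w. word_eq m R v w}"
    by (auto simp: carrier_presented_group)
  moreover from this have "u @ v \<in> words m" by (auto simp: words_def)
  ultimately show "induced_hom G f (X \<otimes>\<^bsub>presented_group m R\<^esub> Y) = induced_hom G f X \<otimes> induced_hom G f Y"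
    by (simp add: mult_presented_group induced_hom_class[OF assms] word_value_append[OF assms(1)])
qed (auto simp: carrier_presented_group induced_hom_class[OF assms] intro!: word_value_closed[OF assms(1)])

lemma (in group) induced_hom_generator:
  assumes "\<And>i. i < m \<Longrightarrow> f i \<in> carrier G"
    and "\<And>u v. (u, v) \<in> R \<Longrightarrow> word_value G f u = word_value G f v"
    and "i < m"
  shows "induced_hom G f (generator m R i) = f i"
  unfolding generator_def
  by (subst induced_hom_class[OF assms(1,2)])
    (use assms(1,3) in \<open>auto simp: words_def word_value_def\<close>)

section \<open>The five groups\<close>

definition D4 :: "word set monoid" where
  "D4 = (let a = (0, True); b = (1, True) in
     presented_group 2 {([a, a, a, a], []), ([b, b], []), ([b, a], [a, a, a, b])})"

definition Q8 :: "word set monoid" where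
  "Q8 = (let a = (0, True); b = (1, True) in
     presented_group 2 {([a, a, a, a], []), ([a, a], [b, b]), ([b, a], [a, a, a, b])})"

definition Z8 :: "word set monoid" where
  "Z8 = (let a = (0, True) in presented_group 1 {([a, a, a, a, a, a, a, a], [])})"

definition Z4xZ2 :: "word set monoid" where
  "Z4xZ2 = (let a = (0, True); b = (1, True) in
     presented_group 2 {([a, a, a, a], []), ([b, b], []), ([a, b], [b, a])})"

definition Z2xZ2xZ2 :: "word set monoid" where
  "Z2xZ2xZ2 = (let a = (0, True); b = (1, True); c = (2, True) in
     presented_group 3 {([a, a], []), ([b, b], []), ([c, c], []),
       ([a, b], [b, a]), ([a, c], [c, a]), ([b, c], [c, b])})"

section \<open>Their irreducible matrix representations\<close>

definition primitive_root_of_unity :: "nat \<Rightarrow> 'a::field \<Rightarrow> bool" where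
  "primitive_root_of_unity m \<omega> \<longleftrightarrow> m > 0 \<and> \<omega> ^ m = 1 \<and> (\<forall>j. 0 < j \<and> j < m \<longrightarrow> \<omega> ^ j \<noteq> 1)"

definition GL_mat :: "nat \<Rightarrow> 'a::field mat monoid" where
  "GL_mat d = units_of (ring_mat TYPE('a) d ())"

text \<open>The representation of degree \<open>d\<close> sending the generator number \<open>i\<close> to the matrix \<open>As ! i\<close>.\<close>

definition mat_rep :: "nat \<Rightarrow> 'a::field mat list \<Rightarrow> word set \<Rightarrow> 'a mat" where
  "mat_rep d As = induced_hom (GL_mat d) (\<lambda>i. As ! i)"

definition char_rep :: "'a::field list \<Rightarrow> word set \<Rightarrow> 'a mat" where
  "char_rep cs = mat_rep 1 (map (\<lambda>c. mat_of_rows_list 1 [[c]]) cs)"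

text \<open>In the lists below, \<open>\<rho>\<^sub>i\<close> is the entry at position \<open>i - 1\<close>.\<close>

definition D4_irreps :: "(word set \<Rightarrow> 'a::field mat) list" where
  "D4_irreps =
     [char_rep [1, 1], char_rep [1, -1], char_rep [-1, -1], char_rep [-1, 1],
      mat_rep 2 [mat_of_rows_list 2 [[0, -1], [1, 0]], mat_of_rows_list 2 [[1, 0], [0, -1]]]]"

definition Q8_irreps :: "'a::field \<Rightarrow> (word set \<Rightarrow> 'a mat) list" where
  "Q8_irreps \<omega> =
     [char_rep [1, 1], char_rep [1, -1], char_rep [-1, -1], char_rep [-1, 1],
      mat_rep 2 [mat_of_rows_list 2 [[\<omega>^2, 0], [0, \<omega>^6]], mat_of_rows_list 2 [[0, 1], [-1, 0]]]]"

definition Z8_irreps :: "'a::field \<Rightarrow> (word set \<Rightarrow> 'a mat) list" where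
  "Z8_irreps \<omega> =
     [char_rep [1], char_rep [\<omega>^4], char_rep [\<omega>], char_rep [\<omega>^7],
      char_rep [\<omega>^2], char_rep [\<omega>^6], char_rep [\<omega>^3], char_rep [\<omega>^5]]"

definition Z4xZ2_irreps :: "'a::field \<Rightarrow> (word set \<Rightarrow> 'a mat) list" where
  "Z4xZ2_irreps \<omega> =
     [char_rep [1, 1], char_rep [1, -1], char_rep [-1, 1], char_rep [-1, -1],
      char_rep [\<omega>^2, 1], char_rep [\<omega>^6, 1], char_rep [\<omega>^2, -1], char_rep [\<omega>^6, -1]]"

definition Z2xZ2xZ2_irreps :: "(word set \<Rightarrow> 'a::field mat) list" where
  "Z2xZ2xZ2_irreps =
     [char_rep [1, 1, 1], char_rep [-1, -1, -1], char_rep [1, -1, 1], char_rep [1, -1, -1],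
      char_rep [1, 1, -1], char_rep [-1, -1, 1], char_rep [-1, 1, 1], char_rep [-1, 1, -1]]"

section \<open>Representations and invariant forms\<close>

text \<open>The vector space is the whole type \<open>'v\<close>, with scalar multiplication \<open>scale\<close>.\<close>

definition GL :: "('a::field \<Rightarrow> 'v::ab_group_add \<Rightarrow> 'v) \<Rightarrow> ('v \<Rightarrow> 'v) monoid" where
  "GL scale =
     \<lparr>carrier = {T. Vector_Spaces.linear scale scale T \<and> bij T}, monoid.mult = (\<circ>), one = id\<rparr>"

text \<open>\<^term>\<open>vector_space.dim\<close> is 0 for infinite-dimensional spaces, so the condition on the
  dimension implies finite dimension when \<open>n > 0\<close>.\<close>

definition representation_of_degree ::
  "nat \<Rightarrow> ('g, 'z) monoid_scheme \<Rightarrow> ('a::field \<Rightarrow> 'v::ab_group_add \<Rightarrow> 'v) \<Rightarrow> ('g \<Rightarrow> 'v \<Rightarrow> 'v) \<Rightarrow> bool" where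
  "representation_of_degree n G scale \<rho> \<longleftrightarrow>
     vector_space scale \<and> vector_space.dim scale UNIV = n \<and> \<rho> \<in> hom G (GL scale)"

definition direct_sum_rep :: "('g \<Rightarrow> 'a::zero mat) list \<Rightarrow> (nat \<Rightarrow> nat) \<Rightarrow> 'g \<Rightarrow> 'a mat" where
  "direct_sum_rep rs k g =
     diag_block_mat (concat (map (\<lambda>i. replicate (k (Suc i)) ((rs ! i) g)) [0..<length rs]))"

text \<open>\<open>\<rho> = \<Oplus>\<^sub>i k\<^sub>i \<rho>\<^sub>i\<close>, where equality of representations is isomorphism: some linear
  isomorphism onto the space of column vectors carries \<open>\<rho>\<close> to the block diagonal representation.\<close>

definition is_direct_sum ::
  "nat \<Rightarrow> ('g, 'z) monoid_scheme \<Rightarrow> ('a::field \<Rightarrow> 'v::ab_group_add \<Rightarrow> 'v) \<Rightarrow> ('g \<Rightarrow> 'v \<Rightarrow> 'v) \<Rightarrow>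
   (nat \<Rightarrow> nat) \<Rightarrow> ('g \<Rightarrow> 'a mat) list \<Rightarrow> bool" where
  "is_direct_sum n G scale \<rho> k rs \<longleftrightarrow>
     (\<exists>\<phi>. bij_betw \<phi> UNIV (carrier_vec n) \<and>
          (\<forall>x y. \<phi> (x + y) = \<phi> x + \<phi> y) \<and>
          (\<forall>c x. \<phi> (scale c x) = c \<cdot>\<^sub>v \<phi> x) \<and>
          (\<forall>g\<in>carrier G. direct_sum_rep rs k g \<in> carrier_mat n n \<and>
             (\<forall>x. \<phi> (\<rho> g x) = direct_sum_rep rs k g *\<^sub>v \<phi> x)))"

definition bilinear_form :: "('a::field \<Rightarrow> 'v::ab_group_add \<Rightarrow> 'v) \<Rightarrow> ('v \<Rightarrow> 'v \<Rightarrow> 'a) \<Rightarrow> bool" where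
  "bilinear_form scale B \<longleftrightarrow>
     (\<forall>x. Vector_Spaces.linear scale (*) (B x)) \<and>
     (\<forall>y. Vector_Spaces.linear scale (*) (\<lambda>x. B x y))"

definition invariant_form :: "('g, 'z) monoid_scheme \<Rightarrow> ('g \<Rightarrow> 'v \<Rightarrow> 'v) \<Rightarrow> ('v \<Rightarrow> 'v \<Rightarrow> 'a) \<Rightarrow> bool" where
  "invariant_form G \<rho> B \<longleftrightarrow> (\<forall>g\<in>carrier G. \<forall>x y. B (\<rho> g x) (\<rho> g y) = B x y)"

definition nondegenerate :: "('v::zero \<Rightarrow> 'v \<Rightarrow> 'a::zero) \<Rightarrow> bool" where
  "nondegenerate B \<longleftrightarrow>
     (\<forall>x. (\<forall>y. B x y = 0) \<longrightarrow> x = 0) \<and> (\<forall>y. (\<forall>x. B x y = 0) \<longrightarrow> y = 0)"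

definition has_nondegenerate_invariant_form ::
  "('g, 'z) monoid_scheme \<Rightarrow> ('a::field \<Rightarrow> 'v::ab_group_add \<Rightarrow> 'v) \<Rightarrow> ('g \<Rightarrow> 'v \<Rightarrow> 'v) \<Rightarrow> bool" where
  "has_nondegenerate_invariant_form G scale \<rho> \<longleftrightarrow>
     (\<exists>B. bilinear_form scale B \<and> invariant_form G \<rho> B \<and> nondegenerate B)"

end

theory Submission
  imports Defs "Jordan_Normal_Form.Determinant"
begin

text \<open>In coordinates, an invariant non-degenerate form is an invertible matrix \<open>J\<close> with
  \<open>M\<^sup>T J M = J\<close> for the matrices \<open>M\<close> of the generators. For the three abelian groups every \<open>M\<close>
  is diagonal, so \<open>J\<close> can have a non-zero entry at \<open>(p, q)\<close> only if the characters at \<open>p\<close> and \<open>q\<close>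
  are inverse to each other. By the Leibniz formula \<open>det J \<noteq> 0\<close> yields a permutation \<open>\<sigma>\<close> such that
  all entries of \<open>J\<close> at \<open>(p, \<sigma> p)\<close> are non-zero, so the multiset of characters is closed under
  inversion; conversely the matrix of such a permutation is a form. For \<open>D4\<close> and \<open>Q8\<close> each
  irreducible summand carries a form of its own: the characters have values \<open>\<plusminus>1\<close>, and \<open>\<rho>\<^sub>5\<close> is
  orthogonal for \<open>D4\<close> and has determinant \<open>1\<close> for \<open>Q8\<close>, hence preserves the alternating form on the
  plane.\<close>

no_notation fps_nth (infixl \<open>$\<close> 75)

section \<open>Matrices\<close>

text \<open>Pairing with unit vectors on both sides reads off single entries. This turns an
  invariance statement about all pairs of vectors into an equation between matrices.\<close>

lemma mat_eqI_scalar_prod: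
  fixes C D :: "'a::semiring_1 mat"
  assumes "C \<in> carrier_mat n n" "D \<in> carrier_mat n n"
    and "\<And>u v. u \<in> carrier_vec n \<Longrightarrow> v \<in> carrier_vec n \<Longrightarrow> u \<bullet> (C *\<^sub>v v) = u \<bullet> (D *\<^sub>v v)"
  shows "C = D"
proof (rule eq_matI)
  have entry: "unit_vec n i \<bullet> (M *\<^sub>v unit_vec n j) = M $$ (i, j)"
    if "M \<in> carrier_mat n n" "i < n" "j < n" for M :: "'a mat" and i j
  proof -
    have "unit_vec n i \<bullet> (M *\<^sub>v unit_vec n j) = (M *\<^sub>v unit_vec n j) $ i"
      using that by (intro scalar_prod_left_unit[of _ n]) auto
    also have "\<dots> = row M i \<bullet> unit_vec n j" using that by simp
    also have "\<dots> = row M i $ j" using that(3) by (rule scalar_prod_right_unit)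
    finally show ?thesis using that by simp
  qed
  fix i j assume "i < dim_row D" "j < dim_col D"
  then show "C $$ (i, j) = D $$ (i, j)"
    using entry[OF assms(1), of i j] entry[OF assms(2), of i j] assms(2)
      assms(3)[of "unit_vec n i" "unit_vec n j"] by auto
qed (use assms in auto)

text \<open>Moving the left factor \<open>M\<close> across the scalar product leaves its transpose.
  It links invariance of the form with matrix \<open>J\<close> to the equation
  \<open>transpose_mat M * J * M = J\<close>.\<close>

lemma transpose_mult_scalar_prod:
  fixes M J :: "'a::comm_semiring_1 mat"
  assumes "M \<in> carrier_mat n n" "J \<in> carrier_mat n n" "u \<in> carrier_vec n" "v \<in> carrier_vec n"
  shows "(M *\<^sub>v u) \<bullet> (J *\<^sub>v (M *\<^sub>v v)) = u \<bullet> ((transpose_mat M * J * M) *\<^sub>v v)"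
proof -
  have eq: "(transpose_mat M * J * M) *\<^sub>v v = transpose_mat M *\<^sub>v (J *\<^sub>v (M *\<^sub>v v))"
    using assms by (simp add: assoc_mult_mat_vec[of _ n n _ n])
  have "u \<bullet> (transpose_mat M *\<^sub>v (J *\<^sub>v (M *\<^sub>v v))) = (transpose_mat M *\<^sub>v (J *\<^sub>v (M *\<^sub>v v))) \<bullet> u"
    using assms by (intro comm_scalar_prod[of _ n]) auto
  also have "\<dots> = (J *\<^sub>v (M *\<^sub>v v)) \<bullet> (M *\<^sub>v u)"
    using assms by (intro transpose_vec_mult_scalar[of _ n n]) auto
  also have "\<dots> = (M *\<^sub>v u) \<bullet> (J *\<^sub>v (M *\<^sub>v v))"
    using assms by (intro comm_scalar_prod[of _ n]) auto
  finally show ?thesis unfolding eq by (rule HOL.sym)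
qed

text \<open>Induction on the number of leading coordinates of \<open>v\<close> that are kept, the
  others being set to 0. Applied to each argument of a bilinear form in turn, it expresses the form
  by its Gram matrix.\<close>

lemma linear_functional_eq_sum_coords:
  fixes f :: "'a::semiring_1 vec \<Rightarrow> 'a"
  assumes add: "\<And>u v. u \<in> carrier_vec n \<Longrightarrow> v \<in> carrier_vec n \<Longrightarrow> f (u + v) = f u + f v"
    and smult: "\<And>c v. v \<in> carrier_vec n \<Longrightarrow> f (c \<cdot>\<^sub>v v) = c * f v"
    and v: "v \<in> carrier_vec n"
  shows "f v = (\<Sum>i<n. v $ i * f (unit_vec n i))"
proof -
  have "k \<le> n \<Longrightarrow> f (vec n (\<lambda>i. if i < k then v $ i else 0)) = (\<Sum>i<k. v $ i * f (unit_vec n i))" for k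
  proof (induction k)
    case 0
    \<comment> \<open>Homogeneity with scalar 0 gives the value at the zero vector; additivity would
      need cancellation, which a semiring does not provide.\<close>
    have "vec n (\<lambda>i. if i < 0 then v $ i else 0) = 0 \<cdot>\<^sub>v (0\<^sub>v n :: 'a vec)" by auto
    then show ?case using smult[of "0\<^sub>v n" 0] by simp
  next
    case (Suc k)
    have "vec n (\<lambda>i. if i < Suc k then v $ i else 0) =
        vec n (\<lambda>i. if i < k then v $ i else 0) + v $ k \<cdot>\<^sub>v unit_vec n k"
      by (rule eq_vecI) (use Suc in \<open>auto simp: unit_vec_def less_Suc_eq\<close>)
    then show ?case using Suc by (simp add: add smult)
  qed
  moreover have "vec n (\<lambda>i. if i < n then v $ i else 0) = v" using v by (intro eq_vecI) auto
  ultimately show ?thesis by (metis order_refl)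
qed

text \<open>Some summand of the Leibniz formula is nonzero, and then so is each of its
  factors.\<close>

lemma det_neq_0_obtains_permutation:
  assumes "A \<in> carrier_mat n n" "det A \<noteq> 0"
  obtains p where "p permutes {..<n}" "\<And>i. i < n \<Longrightarrow> A $$ (i, p i) \<noteq> (0::'a::idom)"
proof -
  have "\<exists>p. p permutes {0..<n} \<and> signof p * (\<Prod>i = 0..<n. A $$ (i, p i)) \<noteq> 0"
  proof (rule ccontr)
    assume "\<nexists>p. p permutes {0..<n} \<and> signof p * (\<Prod>i = 0..<n. A $$ (i, p i)) \<noteq> 0"
    then have "det A = 0"
      unfolding det_def'[OF assms(1)] by (intro sum.neutral ballI) blast
    then show False using assms(2) by contradiction
  qed
  then obtain p where "p permutes {0..<n}" "(\<Prod>i = 0..<n. A $$ (i, p i)) \<noteq> 0" by auto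
  then show thesis by (intro that[of p]) (auto simp: lessThan_atLeast0)
qed

section \<open>Block diagonal matrices\<close>

lemma diag_block_mat_carrier:
  assumes "\<And>x. x \<in> set xs \<Longrightarrow> A x \<in> carrier_mat (d x) (d x)"
  shows "diag_block_mat (map A xs) \<in> carrier_mat (\<Sum>x\<leftarrow>xs. d x) (\<Sum>x\<leftarrow>xs. d x)"
  using assms by (induction xs) (auto simp: Let_def)

text \<open>The off-diagonal blocks vanish, so products are formed block by block. The induction
  splits off the first block and treats all later ones as a single second block.\<close>

lemma diag_block_mat_preserves_form:
  fixes A J :: "'b \<Rightarrow> 'a::comm_ring_1 mat"
  assumes "\<And>x. x \<in> set xs \<Longrightarrow> A x \<in> carrier_mat (d x) (d x)"
    and "\<And>x. x \<in> set xs \<Longrightarrow> J x \<in> carrier_mat (d x) (d x)"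
    and "\<And>x. x \<in> set xs \<Longrightarrow> transpose_mat (A x) * J x * A x = J x"
  shows "transpose_mat (diag_block_mat (map A xs)) * diag_block_mat (map J xs) * diag_block_mat (map A xs) =
    diag_block_mat (map J xs)"
  using assms
proof (induction xs)
  case (Cons x xs)
  let ?m = "d x" and ?n = "\<Sum>x\<leftarrow>xs. d x"
  let ?A = "diag_block_mat (map A xs)" and ?J = "diag_block_mat (map J xs)"
  have c: "A x \<in> carrier_mat ?m ?m" "J x \<in> carrier_mat ?m ?m" using Cons.prems by auto
  have C: "?A \<in> carrier_mat ?n ?n" "?J \<in> carrier_mat ?n ?n"
    using Cons.prems by (auto intro!: diag_block_mat_carrier)
  have IH: "transpose_mat ?A * ?J * ?A = ?J" using Cons by auto
  have hd: "transpose_mat (A x) * J x * A x = J x" using Cons.prems by auto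
  have eA: "diag_block_mat (map A (x # xs)) = four_block_mat (A x) (0\<^sub>m ?m ?n) (0\<^sub>m ?n ?m) ?A"
    and eJ: "diag_block_mat (map J (x # xs)) = four_block_mat (J x) (0\<^sub>m ?m ?n) (0\<^sub>m ?n ?m) ?J"
    using c C by (auto simp: Let_def)
  have eT: "transpose_mat (diag_block_mat (map A (x # xs))) =
      four_block_mat (transpose_mat (A x)) (0\<^sub>m ?m ?n) (0\<^sub>m ?n ?m) (transpose_mat ?A)"
    unfolding eA using c C by (subst transpose_four_block_mat[of _ ?m ?m _ ?n _ ?n]) auto
  have "transpose_mat (diag_block_mat (map A (x # xs))) * diag_block_mat (map J (x # xs)) =
      four_block_mat (transpose_mat (A x) * J x) (0\<^sub>m ?m ?n) (0\<^sub>m ?n ?m) (transpose_mat ?A * ?J)"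
    unfolding eT eJ using c C by (subst mult_four_block_mat[of _ ?m ?m _ ?n _ ?n _ _ ?m _ ?n]) auto
  also have "\<dots> * diag_block_mat (map A (x # xs)) =
      four_block_mat (transpose_mat (A x) * J x * A x) (0\<^sub>m ?m ?n) (0\<^sub>m ?n ?m) (transpose_mat ?A * ?J * ?A)"
    unfolding eA using c C by (subst mult_four_block_mat[of _ ?m ?m _ ?n _ ?n _ _ ?m _ ?n]) auto
  finally show ?case unfolding IH hd eJ .
qed simp

text \<open>The determinant of the first block factors out, and an integral domain has no zero
  divisors.\<close>

lemma det_diag_block_mat_neq_0:
  fixes J :: "'b \<Rightarrow> 'a::idom mat"
  assumes "\<And>x. x \<in> set xs \<Longrightarrow> J x \<in> carrier_mat (d x) (d x)" "\<And>x. x \<in> set xs \<Longrightarrow> det (J x) \<noteq> 0"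
  shows "det (diag_block_mat (map J xs)) \<noteq> 0"
  using assms
proof (induction xs)
  case (Cons x xs)
  let ?m = "d x" and ?n = "\<Sum>x\<leftarrow>xs. d x"
  have c: "J x \<in> carrier_mat ?m ?m" using Cons.prems by auto
  have C: "diag_block_mat (map J xs) \<in> carrier_mat ?n ?n"
    using Cons.prems by (auto intro!: diag_block_mat_carrier)
  have "det (diag_block_mat (map J (x # xs))) = det (J x) * det (diag_block_mat (map J xs))"
    using c C by (auto simp: Let_def intro!: det_four_block_mat_upper_right_zero)
  then show ?case using Cons by auto
qed simp

text \<open>With blocks of size 1 a direct sum of characters becomes an ordinary diagonal matrix
  with known entries.\<close>

lemma diag_block_mat_singletons:
  assumes "i < length xs" "j < length xs"
  shows "diag_block_mat (map (\<lambda>x. mat_of_rows_list 1 [[f x]]) xs) $$ (i, j) =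
    (if i = j then f (xs ! i) else 0)"
  using assms
proof (induction xs arbitrary: i j)
  case (Cons x xs)
  let ?D = "diag_block_mat (map (\<lambda>x. mat_of_rows_list 1 [[f x]]) xs)"
  have D: "?D \<in> carrier_mat (length xs) (length xs)"
    using diag_block_mat_carrier[of xs "\<lambda>x. mat_of_rows_list 1 [[f x]]" "\<lambda>_. 1"]
    by (auto simp: mat_of_rows_list_def sum_list_triv)
  \<comment> \<open>Past the first block, both indices are shifted by one.\<close>
  have "diag_block_mat (map (\<lambda>x. mat_of_rows_list 1 [[f x]]) (x # xs)) $$ (i, j) =
    (if i = 0 then if j = 0 then f x else 0 else if j = 0 then 0 else ?D $$ (i - 1, j - 1))"
    using D Cons.prems unfolding list.map diag_block_mat.simps Let_def
    by (subst index_mat_four_block) (auto simp: mat_of_rows_list_def)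
  also have "\<dots> = (if i = j then f ((x # xs) ! i) else 0)"
    using Cons.prems Cons.IH by (cases i; cases j) (simp_all del: One_nat_def add: One_nat_def[symmetric])
  finally show ?case .
qed simp

section \<open>Invariant forms in coordinates\<close>

lemma generator_closed: "i < m \<Longrightarrow> generator m R i \<in> carrier (presented_group m R)"
  unfolding generator_def carrier_presented_group by (rule imageI) (simp add: words_def)

text \<open>Every element is the class of a word, hence a product of classes of letters, and each
  letter is a generator or the inverse of one.\<close>

lemma presented_group_induct [consumes 1, case_names one gen inv mult]:
  assumes X: "X \<in> carrier (presented_group m R)"
    and one: "P \<one>\<^bsub>presented_group m R\<^esub>"
    and gen: "\<And>i. i < m \<Longrightarrow> P (generator m R i)"
    and inv: "\<And>X. X \<in> carrier (presented_group m R) \<Longrightarrow> P X \<Longrightarrow> P (inv\<^bsub>presented_group m R\<^esub> X)"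
    and mult: "\<And>X Y. X \<in> carrier (presented_group m R) \<Longrightarrow> Y \<in> carrier (presented_group m R) \<Longrightarrow>
      P X \<Longrightarrow> P Y \<Longrightarrow> P (X \<otimes>\<^bsub>presented_group m R\<^esub> Y)"
  shows "P X"
proof -
  interpret G: group "presented_group m R" by (rule group_presented_group)
  let ?cl = "\<lambda>u. {w. word_eq m R u w}"
  have one_eq: "\<one>\<^bsub>presented_group m R\<^esub> = ?cl []" by (simp add: presented_group_def)
  have closed: "?cl u \<in> carrier (presented_group m R)" if "u \<in> words m" for u
    using that by (auto simp: carrier_presented_group)
  have letter: "P (?cl [(i, e)])" if i: "i < m" for i e
  proof (cases e)
    case True
    then show ?thesis using gen[OF i] by (simp add: generator_def)
  next
    case False
    have w: "[(i, False)] \<in> words m" "[(i, True)] \<in> words m" "[] \<in> words m"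
      and w2: "[(i, False)] @ [(i, True)] \<in> words m"
      using i by (auto simp: words_def)
    \<comment> \<open>Free cancellation makes the class of the inverse letter a left inverse of the
      generator; uniqueness of inverses identifies the two.\<close>
    have "?cl [(i, False)] \<otimes>\<^bsub>presented_group m R\<^esub> ?cl [(i, True)] = \<one>\<^bsub>presented_group m R\<^esub>"
      unfolding mult_presented_group[OF w(1,2)] one_eq class_eq_iff[OF w2 w(3)]
      using word_eq.cancel[OF i, of R False] by simp
    then have "inv\<^bsub>presented_group m R\<^esub> (generator m R i) = ?cl [(i, False)]"
      unfolding generator_def using w by (intro G.inv_equality closed)
    then show ?thesis using inv[OF generator_closed[OF i] gen[OF i]] False by simp
  qed
  have "P (?cl u)" if "u \<in> words m" for u
    using that
  proof (induction u)
    case Nil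
    then show ?case using one unfolding one_eq by simp
  next
    case (Cons x u)
    then have w: "[x] \<in> words m" "u \<in> words m" and x: "fst x < m" by (auto simp: words_def)
    have "P (?cl [x] \<otimes>\<^bsub>presented_group m R\<^esub> ?cl u)"
      using Cons.IH[OF w(2)] letter[OF x, of "snd x"] w by (intro mult closed) auto
    then show ?case unfolding mult_presented_group[OF w] by simp
  qed
  then show ?thesis using X by (auto simp: carrier_presented_group)
qed

text \<open>The group elements preserving \<open>B\<close> are closed under products and inverses,
  so testing the generators suffices.\<close>

lemma invariant_form_presented_group:
  assumes \<rho>: "\<rho> \<in> hom (presented_group m R) (GL scale)"
  shows "invariant_form (presented_group m R) \<rho> B \<longleftrightarrow>
    (\<forall>i<m. \<forall>x y. B (\<rho> (generator m R i) x) (\<rho> (generator m R i) y) = B x y)"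
proof
  assume "\<forall>i<m. \<forall>x y. B (\<rho> (generator m R i) x) (\<rho> (generator m R i) y) = B x y"
  then have gen: "\<And>i x y. i < m \<Longrightarrow> B (\<rho> (generator m R i) x) (\<rho> (generator m R i) y) = B x y"
    by blast
  interpret G: group "presented_group m R" by (rule group_presented_group)
  have mult: "\<rho> (X \<otimes>\<^bsub>presented_group m R\<^esub> Y) x = \<rho> X (\<rho> Y x)"
    if "X \<in> carrier (presented_group m R)" "Y \<in> carrier (presented_group m R)" for X Y x
    using hom_mult[OF \<rho> that] by (simp add: GL_def)
  \<comment> \<open>The image of the identity is an injective idempotent map, hence the identity
    map.\<close>
  have one: "\<rho> \<one>\<^bsub>presented_group m R\<^esub> x = x" for x
  proof -
    have "\<rho> \<one>\<^bsub>presented_group m R\<^esub> \<in> carrier (GL scale)"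
      using \<rho> G.one_closed by (rule hom_in_carrier)
    then have "inj (\<rho> \<one>\<^bsub>presented_group m R\<^esub>)"
      by (simp add: GL_def bij_is_inj)
    moreover have "\<rho> \<one>\<^bsub>presented_group m R\<^esub> (\<rho> \<one>\<^bsub>presented_group m R\<^esub> x) = \<rho> \<one>\<^bsub>presented_group m R\<^esub> x"
      using mult[OF G.one_closed G.one_closed] by simp
    ultimately show ?thesis by (rule injD)
  qed
  show "invariant_form (presented_group m R) \<rho> B"
    unfolding invariant_form_def
  proof
    fix X assume "X \<in> carrier (presented_group m R)"
    then show "\<forall>x y. B (\<rho> X x) (\<rho> X y) = B x y"
    proof (induction rule: presented_group_induct)
      case (inv X)
      \<comment> \<open>Invariance under the inverse is invariance under \<open>X\<close> at the
        arguments \<open>\<rho> (inv X) x\<close> and \<open>\<rho> (inv X) y\<close>.\<close>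
      have "\<rho> X (\<rho> (inv\<^bsub>presented_group m R\<^esub> X) x) = x" for x
        using inv(1) by (simp add: one flip: mult)
      then show ?case using inv(2) by metis
    qed (auto simp: one mult gen)
  qed
qed (auto simp: invariant_form_def generator_closed)

text \<open>The coordinate map \<open>\<phi>\<close> matches bilinear forms with their Gram
  matrices; a kernel vector of the matrix is a vector on which the form degenerates, and invariance
  is tested on generators only.\<close>

lemma has_nondegenerate_invariant_form_iff:
  assumes rep: "representation_of_degree n (presented_group m R) scale \<rho>"
    and sum: "is_direct_sum n (presented_group m R) scale \<rho> k rs"
  shows "has_nondegenerate_invariant_form (presented_group m R) scale \<rho> \<longleftrightarrow>
    (\<exists>J\<in>carrier_mat n n. det J \<noteq> 0 \<and>
      (\<forall>i<m. transpose_mat (direct_sum_rep rs k (generator m R i)) * J *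
        direct_sum_rep rs k (generator m R i) = J))"
proof -
  define M where "M = (\<lambda>i. direct_sum_rep rs k (generator m R i))"
  interpret V: vector_space scale
    using rep by (simp add: representation_of_degree_def)
  interpret F: vector_space "(*) :: 'a \<Rightarrow> 'a \<Rightarrow> 'a"
    by unfold_locales (auto simp: algebra_simps)
  have linear_iff: "Vector_Spaces.linear scale (*) f \<longleftrightarrow>
      (\<forall>x y. f (x + y) = f x + f y) \<and> (\<forall>c x. f (scale c x) = c * f x)" for f :: "'b \<Rightarrow> 'a"
    by (auto simp: Vector_Spaces.linear_def module_hom_def module_hom_axioms_def
      V.vector_space_axioms F.vector_space_axioms V.module_axioms F.module_axioms)
  have \<rho>: "\<rho> \<in> hom (presented_group m R) (GL scale)"
    using rep by (simp add: representation_of_degree_def)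
  obtain \<phi> where bij: "bij_betw \<phi> UNIV (carrier_vec n)"
    and add: "\<And>x y. \<phi> (x + y) = \<phi> x + \<phi> y"
    and scale: "\<And>c x. \<phi> (scale c x) = c \<cdot>\<^sub>v \<phi> x"
    and M: "\<And>i. i < m \<Longrightarrow> M i \<in> carrier_mat n n"
    and \<phi>\<rho>: "\<And>i x. i < m \<Longrightarrow> \<phi> (\<rho> (generator m R i) x) = M i *\<^sub>v \<phi> x"
    using sum by (auto simp: is_direct_sum_def M_def generator_closed)
  define \<psi> where "\<psi> = inv_into UNIV \<phi>"
  have \<phi>: "\<phi> x \<in> carrier_vec n" for x using bij by (auto simp: bij_betw_def)
  have \<phi>\<psi>: "\<phi> (\<psi> v) = v" if "v \<in> carrier_vec n" for v
    using bij that unfolding \<psi>_def by (simp add: bij_betw_inv_into_right)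
  have \<psi>\<phi>: "\<psi> (\<phi> x) = x" for x
    using bij unfolding \<psi>_def by (simp add: bij_betw_inv_into_left)
  have \<psi>_add: "\<psi> (u + v) = \<psi> u + \<psi> v" if "u \<in> carrier_vec n" "v \<in> carrier_vec n" for u v
    using that by (metis \<phi>\<psi> \<psi>\<phi> add)
  have \<psi>_smult: "\<psi> (c \<cdot>\<^sub>v v) = scale c (\<psi> v)" if "v \<in> carrier_vec n" for c v
    using that by (metis \<phi>\<psi> \<psi>\<phi> scale)
  have \<phi>_0: "\<phi> x = 0\<^sub>v n \<longleftrightarrow> x = 0" for x
  proof -
    have "\<phi> 0 = 0 \<cdot>\<^sub>v \<phi> 0" using scale[of 0 0] by simp
    also have "\<dots> = 0\<^sub>v n" using \<phi>[of 0] by (intro eq_vecI) auto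
    finally have "\<phi> 0 = 0\<^sub>v n" .
    then show ?thesis by (metis \<psi>\<phi>)
  qed
  have "has_nondegenerate_invariant_form (presented_group m R) scale \<rho> \<longleftrightarrow>
    (\<exists>J\<in>carrier_mat n n. det J \<noteq> 0 \<and> (\<forall>i<m. transpose_mat (M i) * J * M i = J))"
  proof
    assume "has_nondegenerate_invariant_form (presented_group m R) scale \<rho>"
    then obtain B where bil: "bilinear_form scale B"
      and inv: "\<And>i x y. i < m \<Longrightarrow> B (\<rho> (generator m R i) x) (\<rho> (generator m R i) y) = B x y"
      and nondeg: "\<And>y. (\<And>x. B x y = 0) \<Longrightarrow> y = 0"
      unfolding has_nondegenerate_invariant_form_def invariant_form_presented_group[OF \<rho>] nondegenerate_def
      by auto
    \<comment> \<open>The Gram matrix of \<open>B\<close> in the basis that \<open>\<phi>\<close>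
      sends to the unit vectors.\<close>
    define J where "J = mat n n (\<lambda>(p, q). B (\<psi> (unit_vec n p)) (\<psi> (unit_vec n q)))"
    have J: "J \<in> carrier_mat n n" by (simp add: J_def)
    have BJ: "B (\<psi> u) (\<psi> v) = u \<bullet> (J *\<^sub>v v)" if u: "u \<in> carrier_vec n" and v: "v \<in> carrier_vec n" for u v
    proof -
      have "B (\<psi> u) (\<psi> v) = (\<Sum>p<n. u $ p * B (\<psi> (unit_vec n p)) (\<psi> v))"
        using bil by (intro linear_functional_eq_sum_coords[OF _ _ u])
          (auto simp: bilinear_form_def linear_iff \<psi>_add \<psi>_smult)
      also have "\<dots> = (\<Sum>p<n. u $ p * (\<Sum>q<n. v $ q * B (\<psi> (unit_vec n p)) (\<psi> (unit_vec n q))))"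
        using bil by (intro sum.cong refl arg_cong2[of _ _ _ _ "(*)"] linear_functional_eq_sum_coords[OF _ _ v])
          (auto simp: bilinear_form_def linear_iff \<psi>_add \<psi>_smult)
      also have "\<dots> = u \<bullet> (J *\<^sub>v v)"
        using u v by (simp add: scalar_prod_def J_def lessThan_atLeast0 mult.commute)
      finally show ?thesis .
    qed
    have "det J \<noteq> 0"
    proof
      assume "det J = 0"
      \<comment> \<open>A nonzero kernel vector of \<open>J\<close> pulls back to a nonzero vector
        orthogonal to everything.\<close>
      then obtain v where v: "v \<in> carrier_vec n" "v \<noteq> 0\<^sub>v n" "J *\<^sub>v v = 0\<^sub>v n"
        using det_0_iff_vec_prod_zero[OF J] by blast
      have "B x (\<psi> v) = 0" for x
        using BJ[OF \<phi>[of x] v(1)] v(3) \<phi>[of x] by (simp add: \<psi>\<phi>)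
      then show False using nondeg \<phi>_0 \<phi>\<psi> v(1,2) by metis
    qed
    moreover have "transpose_mat (M i) * J * M i = J" if i: "i < m" for i
    proof (rule mat_eqI_scalar_prod)
      fix u v :: "'a vec" assume uv: "u \<in> carrier_vec n" "v \<in> carrier_vec n"
      \<comment> \<open>The intertwining property of \<open>\<phi>\<close>, read through its inverse
        \<open>\<psi>\<close>.\<close>
      have gen: "\<rho> (generator m R i) (\<psi> w) = \<psi> (M i *\<^sub>v w)" if "w \<in> carrier_vec n" for w
        using \<phi>\<rho>[OF i, of "\<psi> w"] that by (metis \<phi>\<psi> \<psi>\<phi>)
      have "(M i *\<^sub>v u) \<bullet> (J *\<^sub>v (M i *\<^sub>v v)) = u \<bullet> (J *\<^sub>v v)"
        using inv[OF i, of "\<psi> u" "\<psi> v"] uv M[OF i] by (simp add: gen BJ)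
      then show "u \<bullet> ((transpose_mat (M i) * J * M i) *\<^sub>v v) = u \<bullet> (J *\<^sub>v v)"
        by (simp add: transpose_mult_scalar_prod[OF M[OF i] J uv])
    qed (use J M[OF i] in auto)
    ultimately show "\<exists>J\<in>carrier_mat n n. det J \<noteq> 0 \<and> (\<forall>i<m. transpose_mat (M i) * J * M i = J)"
      using J by blast
  next
    assume "\<exists>J\<in>carrier_mat n n. det J \<noteq> 0 \<and> (\<forall>i<m. transpose_mat (M i) * J * M i = J)"
    then obtain J where J: "J \<in> carrier_mat n n" and det: "det J \<noteq> 0"
      and inv: "\<And>i. i < m \<Longrightarrow> transpose_mat (M i) * J * M i = J" by blast
    define B where "B = (\<lambda>x y. \<phi> x \<bullet> (J *\<^sub>v \<phi> y))"
    have "bilinear_form scale B"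
      using \<phi> J by (auto simp: bilinear_form_def linear_iff B_def add scale
        add_scalar_prod_distrib[of _ n] scalar_prod_add_distrib[of _ n]
        mult_add_distrib_mat_vec[of _ n n] mult_mat_vec[of _ n n])
    moreover have "invariant_form (presented_group m R) \<rho> B"
      unfolding invariant_form_presented_group[OF \<rho>] B_def
      by (simp add: \<phi>\<rho> transpose_mult_scalar_prod[OF M J \<phi> \<phi>] inv)
    \<comment> \<open>Stated for any invertible \<open>K\<close>, so that \<open>K = J\<close>
      settles the right argument of \<open>B\<close> and \<open>K = transpose_mat J\<close> the left
      one.\<close>
    moreover have right: "y = 0" if "\<And>x. \<phi> x \<bullet> (K *\<^sub>v \<phi> y) = 0"
      and K: "K \<in> carrier_mat n n" "det K \<noteq> 0" for y K
    proof -
      have "K *\<^sub>v \<phi> y = 0\<^sub>v n"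
      proof (rule eq_vecI)
        fix p assume p: "p < dim_vec (0\<^sub>v n :: 'a vec)"
        have "(K *\<^sub>v \<phi> y) $ p = unit_vec n p \<bullet> (K *\<^sub>v \<phi> y)"
          using p K \<phi> by (intro scalar_prod_left_unit[of _ n, symmetric]) auto
        also have "\<dots> = 0" using that(1)[of "\<psi> (unit_vec n p)"] by (simp add: \<phi>\<psi>)
        finally show "(K *\<^sub>v \<phi> y) $ p = 0\<^sub>v n $ p" using p by simp
      qed (use K in auto)
      then show ?thesis using det_0_iff_vec_prod_zero[OF K(1)] K(2) \<phi> \<phi>_0 by blast
    qed
    have "nondegenerate B"
      unfolding nondegenerate_def
    proof (intro conjI allI impI)
      fix y assume "\<forall>x. B x y = 0"
      then show "y = 0" using right[of J y] J det by (simp add: B_def)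
    next
      fix x assume "\<forall>y. B x y = 0"
      moreover have "\<phi> y \<bullet> (transpose_mat J *\<^sub>v \<phi> x) = B x y" for y
        using transpose_vec_mult_scalar[OF J \<phi>[of y] \<phi>[of x]] J \<phi>
        by (simp add: B_def comm_scalar_prod[of _ n])
      ultimately show "x = 0" using right[of "transpose_mat J" x] J det by (simp add: det_transpose)
    qed
    ultimately show "has_nondegenerate_invariant_form (presented_group m R) scale \<rho>"
      by (auto simp: has_nondegenerate_invariant_form_def)
  qed
  then show ?thesis by (simp only: M_def)
qed

section \<open>Direct sums of characters\<close>

text \<open>Each summand contributes its position as often as it occurs. Positions start at 0 while
  multiplicities are numbered from 1, hence \<open>Suc i\<close>. The direct sum thereby becomes a
  \<open>map\<close> over one list, as the block lemmas require.\<close>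

definition summand_indices :: "nat \<Rightarrow> (nat \<Rightarrow> nat) \<Rightarrow> nat list" where
  "summand_indices r k = concat (map (\<lambda>i. replicate (k (Suc i)) i) [0..<r])"

lemma set_summand_indices: "set (summand_indices r k) \<subseteq> {..<r}"
  by (auto simp: summand_indices_def)

lemma direct_sum_rep_eq:
  "direct_sum_rep rs k g = diag_block_mat (map (\<lambda>j. (rs ! j) g) (summand_indices (length rs) k))"
  by (simp add: direct_sum_rep_def summand_indices_def map_concat o_def)

text \<open>Comparing the sizes of the block matrix at one group element recovers \<open>n\<close>
  from the sizes of the summands.\<close>

lemma degree_of_direct_sum:
  assumes "is_direct_sum n G scale \<rho> k rs" "g \<in> carrier G"
    and "\<And>j. j < length rs \<Longrightarrow> (rs ! j) g \<in> carrier_mat (d j) (d j)"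
  shows "n = (\<Sum>j\<leftarrow>summand_indices (length rs) k. d j)"
proof -
  have "direct_sum_rep rs k g \<in> carrier_mat n n"
    using assms(1,2) by (auto simp: is_direct_sum_def)
  moreover have "direct_sum_rep rs k g \<in>
      carrier_mat (\<Sum>j\<leftarrow>summand_indices (length rs) k. d j) (\<Sum>j\<leftarrow>summand_indices (length rs) k. d j)"
    unfolding direct_sum_rep_eq
    using assms(3) set_summand_indices[of "length rs" k] by (intro diag_block_mat_carrier) auto
  ultimately show ?thesis by (metis carrier_matD(1))
qed

text \<open>The orthogonal sum of the forms on the summands is taken, with block diagonal matrix.
  Since \<open>m > 0\<close> there is a generator at which sizes can be compared.\<close>

lemma has_form_if_summands_have_forms:
  assumes rep: "representation_of_degree n (presented_group m R) scale \<rho>"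
    and sum: "is_direct_sum n (presented_group m R) scale \<rho> k rs"
    and "m > 0"
    and A: "\<And>i j. i < m \<Longrightarrow> j < length rs \<Longrightarrow> (rs ! j) (generator m R i) \<in> carrier_mat (d j) (d j)"
    and J: "\<And>j. j < length rs \<Longrightarrow> J j \<in> carrier_mat (d j) (d j)" "\<And>j. j < length rs \<Longrightarrow> det (J j) \<noteq> 0"
    and inv: "\<And>i j. i < m \<Longrightarrow> j < length rs \<Longrightarrow>
      transpose_mat ((rs ! j) (generator m R i)) * J j * (rs ! j) (generator m R i) = J j"
  shows "has_nondegenerate_invariant_form (presented_group m R) scale \<rho>"
proof -
  let ?xs = "summand_indices (length rs) k"
  have xs: "j < length rs" if "j \<in> set ?xs" for j
    using that set_summand_indices by blast
  have n: "n = (\<Sum>j\<leftarrow>?xs. d j)"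
    using degree_of_direct_sum[OF sum generator_closed[OF \<open>m > 0\<close>]] A[OF \<open>m > 0\<close>] by blast
  show ?thesis
    unfolding has_nondegenerate_invariant_form_iff[OF rep sum]
  proof (intro bexI[of _ "diag_block_mat (map J ?xs)"] conjI allI impI)
    show "diag_block_mat (map J ?xs) \<in> carrier_mat n n"
      unfolding n using J(1) xs by (intro diag_block_mat_carrier) auto
    show "det (diag_block_mat (map J ?xs)) \<noteq> 0"
      using J xs by (intro det_diag_block_mat_neq_0[of _ _ d]) auto
  next
    fix i assume "i < m"
    then show "transpose_mat (direct_sum_rep rs k (generator m R i)) * diag_block_mat (map J ?xs) *
        direct_sum_rep rs k (generator m R i) = diag_block_mat (map J ?xs)"
      unfolding direct_sum_rep_eq using A J xs inv by (intro diag_block_mat_preserves_form[of _ _ d]) auto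
  qed
qed

section \<open>Diagonal and permutation matrices\<close>

lemma index_transpose_mult_diag:
  fixes D J :: "'a::comm_semiring_1 mat"
  assumes "D \<in> carrier_mat n n" "J \<in> carrier_mat n n" "p < n" "q < n"
    and D: "\<And>p q. p < n \<Longrightarrow> q < n \<Longrightarrow> D $$ (p, q) = (if p = q then a p else 0)"
  shows "(transpose_mat D * J * D) $$ (p, q) = a p * J $$ (p, q) * a q"
proof -
  \<comment> \<open>The left factor scales rows; the right factor then scales columns.\<close>
  have TJ: "(transpose_mat D * J) $$ (p, r) = a p * J $$ (p, r)" if "r < n" for r
  proof -
    have "(transpose_mat D * J) $$ (p, r) = (\<Sum>s\<in>{0..<n}. D $$ (s, p) * J $$ (s, r))"
      using assms that by (simp add: scalar_prod_def)
    also have "\<dots> = (\<Sum>s\<in>{0..<n}. if s = p then a p * J $$ (p, r) else 0)"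
      using assms(3) by (intro sum.cong) (auto simp: D)
    finally show ?thesis using assms(3) by simp
  qed
  have "(transpose_mat D * J * D) $$ (p, q) = (\<Sum>r\<in>{0..<n}. (transpose_mat D * J) $$ (p, r) * D $$ (r, q))"
    using assms by (simp add: scalar_prod_def del: assoc_mult_mat)
  also have "\<dots> = (\<Sum>r\<in>{0..<n}. if r = q then a p * J $$ (p, q) * a q else 0)"
    using assms(4) by (intro sum.cong) (auto simp: D TJ)
  finally show ?thesis using assms(4) by simp
qed

text \<open>A permutation matrix times its transpose is the identity, so its determinant divides
  1.\<close>

lemma det_permutation_mat_neq_0:
  assumes "\<sigma> permutes {..<n}"
  shows "det (mat n n (\<lambda>(p, q). if q = \<sigma> p then 1 else 0) :: 'a::idom mat) \<noteq> 0"
proof -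
  let ?J = "mat n n (\<lambda>(p, q). if q = \<sigma> p then 1 else 0) :: 'a mat"
  have J: "?J \<in> carrier_mat n n" by simp
  have "?J * transpose_mat ?J = 1\<^sub>m n"
  proof (rule eq_matI)
    fix p q assume "p < dim_row (1\<^sub>m n :: 'a mat)" "q < dim_col (1\<^sub>m n :: 'a mat)"
    then have pq: "p < n" "q < n" by auto
    have "(?J * transpose_mat ?J) $$ (p, q) = (\<Sum>r\<in>{0..<n}. (if r = \<sigma> p then 1 else 0) * (if r = \<sigma> q then 1 else 0))"
      using pq by (simp add: scalar_prod_def)
    also have "\<dots> = (\<Sum>r\<in>{0..<n}. if r = \<sigma> p then if p = q then 1 else 0 else 0)"
      using permutes_inj[OF assms] by (intro sum.cong) (auto simp: inj_eq)
    also have "\<dots> = (if p = q then 1 else 0)"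
      using permutes_in_image[OF assms, of p] pq by simp
    finally show "(?J * transpose_mat ?J) $$ (p, q) = 1\<^sub>m n $$ (p, q)" using pq by simp
  qed auto
  then have "det ?J * det (transpose_mat ?J) = 1"
    using det_mult[of ?J n "transpose_mat ?J"] J by simp
  then show ?thesis by auto
qed

text \<open>A character is encoded by the list of its values on the generators.\<close>

definition character_list :: "'a list list \<Rightarrow> (nat \<Rightarrow> nat) \<Rightarrow> 'a list list" where
  "character_list css k = concat (map (\<lambda>j. replicate (k (Suc j)) (css ! j)) [0..<length css])"

lemma character_list_eq: "character_list css k = map ((!) css) (summand_indices (length css) k)"
  by (simp add: character_list_def summand_indices_def map_concat o_def)

lemma set_character_list: "set (character_list css k) \<subseteq> set css"
  by (auto simp: character_list_def)

text \<open>Since \<open>map inverse\<close> encodes the inverse character, the multiset equation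
  says that each character occurs as often as its inverse.\<close>

lemma has_form_iff_characters_inverse_closed:
  fixes scale :: "'a::field \<Rightarrow> 'v::ab_group_add \<Rightarrow> 'v"
  assumes rep: "representation_of_degree n (presented_group m R) scale \<rho>"
    and sum: "is_direct_sum n (presented_group m R) scale \<rho> k (map char_rep css)"
    and "m > 0"
    and len: "\<And>c. c \<in> set css \<Longrightarrow> length c = m"
    and nz: "\<And>c. c \<in> set css \<Longrightarrow> 0 \<notin> set c"
    and gen: "\<And>c i. c \<in> set css \<Longrightarrow> i < m \<Longrightarrow> char_rep c (generator m R i) = mat_of_rows_list 1 [[c ! i]]"
  shows "has_nondegenerate_invariant_form (presented_group m R) scale \<rho> \<longleftrightarrow>
    image_mset (map inverse) (mset (character_list css k)) = mset (character_list css k)"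
proof -
  define L where "L = character_list css k"
  define M where "M = (\<lambda>i. direct_sum_rep (map char_rep css) k (generator m R i))"
  have L: "c \<in> set css" if "c \<in> set L" for c
    using that set_character_list unfolding L_def by blast
  have M_eq: "M i = diag_block_mat (map (\<lambda>c. mat_of_rows_list 1 [[c ! i]]) L)" if "i < m" for i
  proof -
    have "M i = diag_block_mat (map (\<lambda>j. char_rep (css ! j) (generator m R i)) (summand_indices (length css) k))"
      unfolding M_def direct_sum_rep_eq length_map
      using set_summand_indices[of "length css" k]
      by (intro arg_cong[of _ _ diag_block_mat] map_cong) auto
    also have "\<dots> = diag_block_mat (map (\<lambda>c. char_rep c (generator m R i)) L)"
      by (simp add: L_def character_list_eq o_def)
    also have "\<dots> = diag_block_mat (map (\<lambda>c. mat_of_rows_list 1 [[c ! i]]) L)"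
      using that L gen by (intro arg_cong[of _ _ diag_block_mat] map_cong) auto
    finally show ?thesis .
  qed
  have n: "n = length L"
  proof -
    have "n = (\<Sum>j\<leftarrow>summand_indices (length css) k. 1)"
      using degree_of_direct_sum[OF sum generator_closed[OF \<open>m > 0\<close>], of "\<lambda>_. 1"] gen[OF _ \<open>m > 0\<close>]
      by (simp add: mat_of_rows_list_def)
    then show ?thesis by (simp add: L_def character_list_eq sum_list_triv)
  qed
  have M: "M i \<in> carrier_mat n n" if "i < m" for i
    using sum generator_closed[OF that] by (auto simp: M_def is_direct_sum_def)
  have entry: "(transpose_mat (M i) * J * M i) $$ (p, q) = L ! p ! i * J $$ (p, q) * L ! q ! i"
    if "i < m" "J \<in> carrier_mat n n" "p < n" "q < n" for i p q J
    by (rule index_transpose_mult_diag[OF M[OF that(1)] that(2-4)])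
      (unfold M_eq[OF that(1)] n, rule diag_block_mat_singletons)
  have lenL: "length (L ! p) = m" if "p < n" for p
    using that len L n by simp
  have nzL: "L ! p ! i \<noteq> 0" if "p < n" "i < m" for p i
    using that nz[OF L[OF nth_mem[of p L]]] lenL[of p] n by (metis nth_mem)
  have "(\<exists>J\<in>carrier_mat n n. det J \<noteq> 0 \<and> (\<forall>i<m. transpose_mat (M i) * J * M i = J)) \<longleftrightarrow>
    mset (map (map inverse) L) = mset L"
  proof
    assume "\<exists>J\<in>carrier_mat n n. det J \<noteq> 0 \<and> (\<forall>i<m. transpose_mat (M i) * J * M i = J)"
    then obtain J where J: "J \<in> carrier_mat n n" and det: "det J \<noteq> 0"
      and inv: "\<And>i. i < m \<Longrightarrow> transpose_mat (M i) * J * M i = J" by blast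
    obtain \<sigma> where \<sigma>: "\<sigma> permutes {..<n}" and J\<sigma>: "\<And>p. p < n \<Longrightarrow> J $$ (p, \<sigma> p) \<noteq> 0"
      using det_neq_0_obtains_permutation[OF J det] by blast
    have "map (map inverse) L = permute_list \<sigma> L"
    proof (rule nth_equalityI)
      fix p assume "p < length (map (map inverse) L)"
      then have p: "p < n" and \<sigma>p: "\<sigma> p < n" using permutes_in_image[OF \<sigma>, of p] n by auto
      \<comment> \<open>At a nonzero entry \<open>J $$ (p, \<sigma> p)\<close>, invariance forces
        the two character values to multiply to 1.\<close>
      have "inverse (L ! p ! i) = L ! \<sigma> p ! i" if i: "i < m" for i
        using entry[OF i J p \<sigma>p] J\<sigma>[OF p] nzL[OF p i] by (simp add: inv[OF i] field_simps)
      then have "map inverse (L ! p) = L ! \<sigma> p"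
        using lenL p \<sigma>p by (intro nth_equalityI) auto
      then show "map (map inverse) L ! p = permute_list \<sigma> L ! p"
        using p n \<sigma> by (simp add: permute_list_nth)
    qed simp
    then show "mset (map (map inverse) L) = mset L"
      using \<sigma> n by (simp only: mset_permute_list)
  next
    assume "mset (map (map inverse) L) = mset L"
    then obtain \<sigma> where \<sigma>: "\<sigma> permutes {..<n}" and perm: "permute_list \<sigma> L = map (map inverse) L"
      using mset_eq_permutation n by metis
    have L\<sigma>: "L ! \<sigma> p = map inverse (L ! p)" if "p < n" for p
      using arg_cong[OF perm, of "\<lambda>xs. xs ! p"] that n \<sigma> by (simp add: permute_list_nth)
    \<comment> \<open>This form pairs each basis vector with one belonging to the inverse
      character.\<close>
    let ?J = "mat n n (\<lambda>(p, q). if q = \<sigma> p then 1 else 0) :: 'a mat"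
    have "transpose_mat (M i) * ?J * M i = ?J" if i: "i < m" for i
    proof (rule eq_matI)
      fix p q assume "p < dim_row ?J" "q < dim_col ?J"
      then have pq: "p < n" "q < n" by auto
      have "(transpose_mat (M i) * ?J * M i) $$ (p, q) = L ! p ! i * ?J $$ (p, q) * L ! q ! i"
        using i pq by (intro entry) auto
      \<comment> \<open>Off the positions \<open>(p, \<sigma> p)\<close> both sides are 0; on them
        the two values cancel.\<close>
      also have "\<dots> = ?J $$ (p, q)"
        using pq i nzL[OF pq(1) i] lenL[OF pq(1)] by (auto simp: L\<sigma>)
      finally show "(transpose_mat (M i) * ?J * M i) $$ (p, q) = ?J $$ (p, q)" .
    qed (use M[OF i] in auto)
    then show "\<exists>J\<in>carrier_mat n n. det J \<noteq> 0 \<and> (\<forall>i<m. transpose_mat (M i) * J * M i = J)"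
      using det_permutation_mat_neq_0[OF \<sigma>] by (intro bexI[of _ ?J]) auto
  qed
  then show ?thesis
    unfolding has_nondegenerate_invariant_form_iff[OF rep sum] M_def L_def by simp
qed

section \<open>Values of the matrix representations on generators\<close>

lemma group_GL_mat: "group (GL_mat d :: 'a::field mat monoid)"
proof -
  interpret ring "ring_mat TYPE('a) d ()" by (rule ring_mat)
  show ?thesis unfolding GL_mat_def by (rule units_group)
qed

lemma GL_mat_simps:
  "A \<otimes>\<^bsub>GL_mat d\<^esub> B = A * B" "\<one>\<^bsub>GL_mat d\<^esub> = 1\<^sub>m d"
  by (simp_all add: GL_mat_def units_of_def ring_mat_def)

text \<open>Nonzero determinants place the matrices in the unit group, and the relations make the
  induced homomorphism well defined.\<close>

lemma mat_rep_generator: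
  assumes "i < m"
    and "\<And>i. i < m \<Longrightarrow> As ! i \<in> carrier_mat d d" "\<And>i. i < m \<Longrightarrow> det (As ! i) \<noteq> 0"
    and "\<And>u v. (u, v) \<in> R \<Longrightarrow> word_value (GL_mat d) ((!) As) u = word_value (GL_mat d) ((!) As) v"
  shows "mat_rep d As (generator m R i) = As ! i"
proof -
  have "As ! i \<in> carrier (GL_mat d)" if "i < m" for i
    unfolding GL_mat_def units_of_carrier using assms(2,3)[OF that] by (rule det_non_zero_imp_unit)
  then show ?thesis
    unfolding mat_rep_def using group.induced_hom_generator[OF group_GL_mat _ assms(4,1)] by blast
qed

lemma mult_mat_1x1:
  "mat_of_rows_list 1 [[a]] * mat_of_rows_list 1 [[b]] = mat_of_rows_list 1 [[a * b]]"
  by (rule eq_matI) (auto simp: mat_of_rows_list_def scalar_prod_def)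

text \<open>Matrices of size 1 multiply like scalars. Restricting to words without inverse letters
  avoids computing inverses in \<open>GL_mat 1\<close>.\<close>

lemma word_value_1x1:
  assumes "\<And>x. x \<in> set w \<Longrightarrow> snd x \<and> fst x < length c"
  shows "word_value (GL_mat 1) ((!) (map (\<lambda>c. mat_of_rows_list 1 [[c]]) c)) w =
    mat_of_rows_list 1 [[\<Prod>x\<leftarrow>w. c ! fst x]]"
  using assms
proof (induction w)
  case Nil
  show ?case by (rule eq_matI) (auto simp: word_value_def GL_mat_simps mat_of_rows_list_def)
next
  case (Cons x w)
  let ?f = "(!) (map (\<lambda>c. mat_of_rows_list 1 [[c]]) c)"
  have x: "snd x" "fst x < length c" using Cons.prems[of x] by auto
  have "word_value (GL_mat 1) ?f (x # w) = ?f (fst x) * word_value (GL_mat 1) ?f w"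
    using x(1) by (cases x) (simp add: word_value_def GL_mat_simps)
  also have "?f (fst x) = mat_of_rows_list 1 [[c ! fst x]]" using x(2) by (rule nth_map)
  also have "word_value (GL_mat 1) ?f w = mat_of_rows_list 1 [[\<Prod>x\<leftarrow>w. c ! fst x]]"
    using Cons by simp
  finally show ?case by (simp only: mult_mat_1x1 list.map prod_list.Cons)
qed

text \<open>Checking the relations reduces to identities between products of the scalars
  \<open>c ! i\<close>.\<close>

lemma char_rep_generator:
  assumes "i < m" "length c = m" "0 \<notin> set c"
    and R: "\<And>u v x. (u, v) \<in> R \<Longrightarrow> x \<in> set u \<union> set v \<Longrightarrow> snd x \<and> fst x < m"
    and val: "\<And>u v. (u, v) \<in> R \<Longrightarrow> (\<Prod>x\<leftarrow>u. c ! fst x) = (\<Prod>x\<leftarrow>v. c ! fst x)"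
  shows "char_rep c (generator m R i) = mat_of_rows_list 1 [[c ! i]]"
proof -
  let ?As = "map (\<lambda>c. mat_of_rows_list 1 [[c]]) c"
  have "mat_rep 1 ?As (generator m R i) = ?As ! i"
  proof (rule mat_rep_generator)
    fix i assume i: "i < m"
    show c: "?As ! i \<in> carrier_mat 1 1"
      using i assms(2) by (simp add: mat_of_rows_list_def)
    have "c ! i \<noteq> 0" using i assms(2,3) by (metis nth_mem)
    then show "det (?As ! i) \<noteq> 0"
      using i assms(2) c by (simp add: det_single mat_of_rows_list_def)
  next
    fix u v assume uv: "(u, v) \<in> R"
    have "word_value (GL_mat 1) ((!) ?As) w = mat_of_rows_list 1 [[\<Prod>x\<leftarrow>w. c ! fst x]]"
      if "w = u \<or> w = v" for w
      using that R[OF uv] assms(2) by (intro word_value_1x1) auto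
    then show "word_value (GL_mat 1) ((!) ?As) u = word_value (GL_mat 1) ((!) ?As) v"
      using val[OF uv] by metis
  qed (rule assms(1))
  then show ?thesis using assms(1,2) by (simp add: char_rep_def)
qed

section \<open>The abelian groups\<close>

text \<open>Two equal powers with different exponents below \<open>m\<close> would make a smaller
  positive power equal to 1, against primitivity.\<close>

lemma primitive_root_power_eq_iff:
  assumes "primitive_root_of_unity m \<omega>" "i < m" "j < m"
  shows "\<omega> ^ i = \<omega> ^ j \<longleftrightarrow> i = j"
proof -
  have *: "\<omega> ^ i \<noteq> \<omega> ^ j" if "i < j" "j < m" for i j
  proof
    assume "\<omega> ^ i = \<omega> ^ j"
    then have "\<omega> ^ i * \<omega> ^ (j - i) = \<omega> ^ i * 1" using that by (subst power_add[symmetric]) simp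
    moreover have "\<omega> \<noteq> 0" using assms(1) by (auto simp: primitive_root_of_unity_def zero_power)
    ultimately have "\<omega> ^ (j - i) = 1" by simp
    then show False using assms(1) that by (auto simp: primitive_root_of_unity_def)
  qed
  then show ?thesis using assms(2,3) by (metis linorder_neqE_nat)
qed

lemma primitive_root_inverse_power:
  assumes "primitive_root_of_unity m \<omega>" "j \<le> m"
  shows "inverse (\<omega> ^ j) = \<omega> ^ (m - j)"
  using assms by (intro inverse_unique) (simp add: primitive_root_of_unity_def flip: power_add)

text \<open>The power squares to 1 but is not 1 by primitivity, so in a field it is -1.\<close>

lemma primitive_root_half_power:
  assumes "primitive_root_of_unity (2 * m) \<omega>"
  shows "\<omega> ^ m = -1"
proof -
  have "m > 0" and sq: "(\<omega> ^ m) ^ 2 = 1"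
    using assms by (auto simp: primitive_root_of_unity_def power_mult[symmetric] mult.commute)
  moreover have "\<omega> ^ m \<noteq> 1" using assms \<open>m > 0\<close> by (auto simp: primitive_root_of_unity_def)
  ultimately show ?thesis by (simp add: power2_eq_1_iff)
qed

text \<open>Inversion fixes 1 and \<open>\<omega>^4\<close> and exchanges \<open>\<omega>\<close>
  with \<open>\<omega>^7\<close>, \<open>\<omega>^2\<close> with \<open>\<omega>^6\<close>, and
  \<open>\<omega>^3\<close> with \<open>\<omega>^5\<close>; these pairs are the characters 3 and 4,
  5 and 6, 7 and 8.\<close>

lemma Z8_has_form_iff:
  fixes scale :: "'a::field \<Rightarrow> 'v::ab_group_add \<Rightarrow> 'v"
  assumes prim: "primitive_root_of_unity 8 \<omega>"
    and "representation_of_degree n Z8 scale \<rho>" "is_direct_sum n Z8 scale \<rho> k (Z8_irreps \<omega>)"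
  shows "has_nondegenerate_invariant_form Z8 scale \<rho> \<longleftrightarrow> k 3 = k 4 \<and> k 5 = k 6 \<and> k 7 = k 8"
proof -
  let ?css = "[[1], [\<omega>^4], [\<omega>^1], [\<omega>^7], [\<omega>^2], [\<omega>^6], [\<omega>^3], [\<omega>^5]]"
  define L where "L = mset (character_list ?css k)"
  have irreps: "Z8_irreps \<omega> = map char_rep ?css" by (simp add: Z8_irreps_def)
  have nz: "\<omega> \<noteq> 0" and \<omega>8: "\<omega> ^ 8 = 1"
    using prim by (auto simp: primitive_root_of_unity_def)
  have pow8: "(\<omega> ^ j) ^ 8 = 1" for j
    using \<omega>8 by (metis mult.commute power_mult power_one)
  have "has_nondegenerate_invariant_form Z8 scale \<rho> \<longleftrightarrow> image_mset (map inverse) L = L"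
    using assms(2,3) unfolding L_def irreps Z8_def Let_def
  proof (rule has_form_iff_characters_inverse_closed)
    fix c i assume c: "c \<in> set ?css" and i: "i < (1::nat)"
    show "char_rep c (generator 1 {([(0, True), (0, True), (0, True), (0, True), (0, True),
        (0, True), (0, True), (0, True)], [])} i) = mat_of_rows_list 1 [[c ! i]]"
      by (rule char_rep_generator)
        (use c i nz pow8 \<omega>8 in \<open>auto simp: power_numeral_reduce algebra_simps\<close>)
  qed (use nz in auto)
  also have "\<dots> \<longleftrightarrow> k 3 = k 4 \<and> k 5 = k 6 \<and> k 7 = k 8"
  proof -
    note inj = primitive_root_power_eq_iff[OF prim]
    \<comment> \<open>Simplification turns \<open>\<omega>^0\<close> into 1 and
      \<open>\<omega>^1\<close> into \<open>\<omega>\<close>, so the distinctness facts are also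
      supplied in these normal forms.\<close>
    note ne = inj[of 0, simplified] inj[of _ 0, simplified] inj[of 1, simplified] inj[of _ 1, simplified] inj
    have inv: "inverse (\<omega> ^ j) = \<omega> ^ (8 - j)" if "j \<le> 8" for j
      using primitive_root_inverse_power[OF prim that] .
    have L: "L = replicate_mset (k 1) [1] + replicate_mset (k 2) [\<omega>^4] +
        replicate_mset (k 3) [\<omega>^1] + replicate_mset (k 4) [\<omega>^7] + replicate_mset (k 5) [\<omega>^2] +
        replicate_mset (k 6) [\<omega>^6] + replicate_mset (k 7) [\<omega>^3] + replicate_mset (k 8) [\<omega>^5]"
      by (simp add: L_def character_list_def upt_conv_Cons eval_nat_numeral)
    have L': "image_mset (map inverse) L = replicate_mset (k 1) [1] + replicate_mset (k 2) [\<omega>^4] +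
        replicate_mset (k 3) [\<omega>^7] + replicate_mset (k 4) [\<omega>^1] + replicate_mset (k 5) [\<omega>^6] +
        replicate_mset (k 6) [\<omega>^2] + replicate_mset (k 7) [\<omega>^5] + replicate_mset (k 8) [\<omega>^3]"
      unfolding L by (simp add: inv inv[of 1, simplified])
    show ?thesis
    proof
      assume eq: "image_mset (map inverse) L = L"
      have "count (image_mset (map inverse) L) [\<omega> ^ j] = count L [\<omega> ^ j]" for j
        by (simp only: eq)
      \<comment> \<open>One representative from each exchanged pair suffices: its multiplicity is
        compared with that of its inverse.\<close>
      from this[of 1] this[of 2] this[of 3] show "k 3 = k 4 \<and> k 5 = k 6 \<and> k 7 = k 8"
        unfolding L' unfolding L by (simp add: ne)
    next
      assume "k 3 = k 4 \<and> k 5 = k 6 \<and> k 7 = k 8"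
      then show "image_mset (map inverse) L = L"
        unfolding L' unfolding L by (simp add: ac_simps)
    qed
  qed
  finally show ?thesis .
qed

text \<open>Inversion fixes the four characters with values 1 and -1 only; on the others it
  exchanges \<open>\<omega>^2\<close> with \<open>\<omega>^6\<close> and keeps the value at
  \<open>b\<close>.\<close>

lemma Z4xZ2_has_form_iff:
  fixes scale :: "'a::field \<Rightarrow> 'v::ab_group_add \<Rightarrow> 'v"
  assumes prim: "primitive_root_of_unity 8 \<omega>"
    and "representation_of_degree n Z4xZ2 scale \<rho>" "is_direct_sum n Z4xZ2 scale \<rho> k (Z4xZ2_irreps \<omega>)"
  shows "has_nondegenerate_invariant_form Z4xZ2 scale \<rho> \<longleftrightarrow> k 5 = k 6 \<and> k 7 = k 8"
proof -
  let ?css = "[[1, 1], [1, -1], [-1, 1], [-1, -1], [\<omega>^2, 1], [\<omega>^6, 1], [\<omega>^2, -1], [\<omega>^6, -1]]"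
  define L where "L = mset (character_list ?css k)"
  have irreps: "Z4xZ2_irreps \<omega> = map char_rep ?css" by (simp add: Z4xZ2_irreps_def)
  have \<omega>4: "\<omega> ^ 4 = -1" using primitive_root_half_power[of 4 \<omega>] prim by simp
  have nz: "\<omega> \<noteq> 0" and \<omega>8: "\<omega> ^ 8 = 1"
    using prim by (auto simp: primitive_root_of_unity_def)
  have pow4: "(\<omega> ^ 2) ^ 4 = 1" "(\<omega> ^ 6) ^ 4 = 1"
    using \<omega>8 power_mult[of \<omega> 8 3] by (simp_all flip: power_mult)
  have "has_nondegenerate_invariant_form Z4xZ2 scale \<rho> \<longleftrightarrow> image_mset (map inverse) L = L"
    using assms(2,3) unfolding L_def irreps Z4xZ2_def Let_def
  proof (rule has_form_iff_characters_inverse_closed)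
    fix c i assume c: "c \<in> set ?css" and i: "i < (2::nat)"
    show "char_rep c (generator 2 {([(0, True), (0, True), (0, True), (0, True)], []),
        ([(1, True), (1, True)], []), ([(0, True), (1, True)], [(1, True), (0, True)])} i) =
      mat_of_rows_list 1 [[c ! i]]"
      by (rule char_rep_generator)
        (use c i nz pow4 in \<open>auto simp: power_numeral_reduce algebra_simps\<close>)
  qed (use nz in auto)
  also have "\<dots> \<longleftrightarrow> k 5 = k 6 \<and> k 7 = k 8"
  proof -
    note inj = primitive_root_power_eq_iff[OF prim]
    \<comment> \<open>Writing 1 as \<open>\<omega>^0\<close> and -1 as \<open>\<omega>^4\<close>
      makes all of these distinctness statements about powers below 8.\<close>
    have ne: "\<omega>^2 \<noteq> 1" "\<omega>^6 \<noteq> 1" "\<omega>^2 \<noteq> -1" "\<omega>^6 \<noteq> -1" "\<omega>^2 \<noteq> \<omega>^6" "(1::'a) \<noteq> -1"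
      using inj[of 2 0] inj[of 6 0] inj[of 2 4] inj[of 6 4] inj[of 2 6] inj[of 0 4] \<omega>4 by auto
    have inv: "inverse (\<omega> ^ 2) = \<omega> ^ 6" "inverse (\<omega> ^ 6) = \<omega> ^ 2"
      using primitive_root_inverse_power[OF prim, of 2] primitive_root_inverse_power[OF prim, of 6]
      by simp_all
    have L: "L = replicate_mset (k 1) [1, 1] + replicate_mset (k 2) [1, -1] +
        replicate_mset (k 3) [-1, 1] + replicate_mset (k 4) [-1, -1] + replicate_mset (k 5) [\<omega>^2, 1] +
        replicate_mset (k 6) [\<omega>^6, 1] + replicate_mset (k 7) [\<omega>^2, -1] + replicate_mset (k 8) [\<omega>^6, -1]"
      by (simp add: L_def character_list_def upt_conv_Cons eval_nat_numeral)
    have L': "image_mset (map inverse) L = replicate_mset (k 1) [1, 1] + replicate_mset (k 2) [1, -1] +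
        replicate_mset (k 3) [-1, 1] + replicate_mset (k 4) [-1, -1] + replicate_mset (k 5) [\<omega>^6, 1] +
        replicate_mset (k 6) [\<omega>^2, 1] + replicate_mset (k 7) [\<omega>^6, -1] + replicate_mset (k 8) [\<omega>^2, -1]"
      unfolding L by (simp add: inv)
    show ?thesis
    proof
      assume eq: "image_mset (map inverse) L = L"
      \<comment> \<open>The value \<open>e\<close> at \<open>b\<close> selects the pair: 1 compares
        \<open>k 5\<close> with \<open>k 6\<close>, and -1 compares \<open>k 7\<close> with
        \<open>k 8\<close>.\<close>
      have "count (image_mset (map inverse) L) [\<omega>^2, e] = count L [\<omega>^2, e]" for e
        by (simp only: eq)
      from this[of 1] this[of "-1"] show "k 5 = k 6 \<and> k 7 = k 8"
        unfolding L' unfolding L using ne ne[THEN not_sym] by simp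
    next
      assume "k 5 = k 6 \<and> k 7 = k 8"
      then show "image_mset (map inverse) L = L"
        unfolding L' unfolding L by (simp add: ac_simps)
    qed
  qed
  finally show ?thesis .
qed

text \<open>All values are 1 or -1, so every character is its own inverse and the criterion holds
  for all multiplicities.\<close>

lemma Z2xZ2xZ2_has_form:
  fixes scale :: "'a::field \<Rightarrow> 'v::ab_group_add \<Rightarrow> 'v"
  assumes "representation_of_degree n Z2xZ2xZ2 scale \<rho>" "is_direct_sum n Z2xZ2xZ2 scale \<rho> k Z2xZ2xZ2_irreps"
  shows "has_nondegenerate_invariant_form Z2xZ2xZ2 scale \<rho>"
proof -
  let ?css = "[[1, 1, 1], [-1, -1, -1], [1, -1, 1], [1, -1, -1], [1, 1, -1], [-1, -1, 1], [-1, 1, 1],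
    [-1, 1, -1]] :: 'a list list"
  have irreps: "Z2xZ2xZ2_irreps = map char_rep ?css" by (simp add: Z2xZ2xZ2_irreps_def)
  have "has_nondegenerate_invariant_form Z2xZ2xZ2 scale \<rho> \<longleftrightarrow>
      image_mset (map inverse) (mset (character_list ?css k)) = mset (character_list ?css k)"
    using assms unfolding irreps Z2xZ2xZ2_def Let_def
  proof (rule has_form_iff_characters_inverse_closed)
    fix c :: "'a list" and i assume c: "c \<in> set ?css" and i: "i < (3::nat)"
    show "char_rep c (generator 3 {([(0, True), (0, True)], []), ([(1, True), (1, True)], []),
        ([(2, True), (2, True)], []), ([(0, True), (1, True)], [(1, True), (0, True)]),
        ([(0, True), (2, True)], [(2, True), (0, True)]), ([(1, True), (2, True)], [(2, True), (1, True)])} i) =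
      mat_of_rows_list 1 [[c ! i]]"
      by (rule char_rep_generator) (use c i in auto)
  qed auto
  moreover have "map inverse c = c" if "c \<in> set (character_list ?css k)" for c
    using subsetD[OF set_character_list that] by auto
  then have "image_mset (map inverse) (mset (character_list ?css k)) = mset (character_list ?css k)"
    by (subst image_mset_cong[of _ _ id]) auto
  ultimately show ?thesis by blast
qed

section \<open>The groups \<open>D4\<close> and \<open>Q8\<close>\<close>

lemma mat_2x2_simps:
  fixes a b c d a' b' c' d' :: "'a::comm_ring_1"
  shows mult_mat_2x2: "mat_of_rows_list 2 [[a, b], [c, d]] * mat_of_rows_list 2 [[a', b'], [c', d']] =
      mat_of_rows_list 2 [[a * a' + b * c', a * b' + b * d'], [c * a' + d * c', c * b' + d * d']]"
    and transpose_mat_2x2: "transpose_mat (mat_of_rows_list 2 [[a, b], [c, d]]) = mat_of_rows_list 2 [[a, c], [b, d]]"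
    and one_mat_2x2: "1\<^sub>m 2 = mat_of_rows_list 2 [[1, 0], [0, 1 :: 'a]]"
  by (rule eq_matI; auto simp: mat_of_rows_list_def scalar_prod_def less_Suc_eq numeral_2_eq_2)+

lemma mat_2x2_carrier: "mat_of_rows_list 2 [[a, b], [c, d]] \<in> carrier_mat 2 2"
  by (auto simp: mat_of_rows_list_def)

lemma det_mat_2x2:
  "det (mat_of_rows_list 2 [[a, b], [c, d]]) = a * d - b * (c :: 'a::comm_ring_1)"
proof -
  let ?A = "mat_of_rows_list 2 [[a, b], [c, d]]"
  have "det ?A = (\<Sum>j<2. ?A $$ (0, j) * cofactor ?A 0 j)"
    by (rule laplace_expansion_row[OF mat_2x2_carrier]) simp
  also have "\<dots> = ?A $$ (0, 0) * cofactor ?A 0 0 + ?A $$ (0, 1) * cofactor ?A 0 1"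
    by (simp add: numeral_2_eq_2)
  also have "cofactor ?A 0 0 = d"
    by (simp add: cofactor_def det_single mat_delete_def mat_of_rows_list_def)
  also have "cofactor ?A 0 1 = - c"
    by (simp add: cofactor_def det_single mat_delete_def mat_of_rows_list_def)
  finally show ?thesis by (simp add: mat_of_rows_list_def)
qed

text \<open>A character with values squaring to 1 preserves the product form, whose matrix is
  \<open>[[1]]\<close>; \<open>J\<close> serves the copies of \<open>r\<close>, which sits at
  position \<open>length css\<close>.\<close>

lemma has_form_of_signs_and_2x2:
  fixes scale :: "'a::field \<Rightarrow> 'v::ab_group_add \<Rightarrow> 'v"
  assumes rep: "representation_of_degree n (presented_group m R) scale \<rho>"
    and sum: "is_direct_sum n (presented_group m R) scale \<rho> k (map char_rep css @ [r])"
    and "m > 0"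
    and chars: "\<And>c i. c \<in> set css \<Longrightarrow> i < m \<Longrightarrow> char_rep c (generator m R i) = mat_of_rows_list 1 [[c ! i]]"
    and signs: "\<And>c i. c \<in> set css \<Longrightarrow> i < m \<Longrightarrow> c ! i * c ! i = 1"
    and r: "\<And>i. i < m \<Longrightarrow> r (generator m R i) \<in> carrier_mat d d"
    and J: "J \<in> carrier_mat d d" "det J \<noteq> 0"
    and inv: "\<And>i. i < m \<Longrightarrow> transpose_mat (r (generator m R i)) * J * r (generator m R i) = J"
  shows "has_nondegenerate_invariant_form (presented_group m R) scale \<rho>"
proof (rule has_form_if_summands_have_forms[OF rep sum \<open>m > 0\<close>,
      where d = "\<lambda>j. if j < length css then 1 else d" and
        J = "\<lambda>j. if j < length css then mat_of_rows_list 1 [[1]] else J"])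
  fix i j assume ij: "i < m" "j < length (map char_rep css @ [r])"
  have tr: "transpose_mat (mat_of_rows_list 1 [[a]]) = mat_of_rows_list 1 [[a]]" for a :: 'a
    by (rule eq_matI) (auto simp: mat_of_rows_list_def)
  show "((map char_rep css @ [r]) ! j) (generator m R i) \<in>
      carrier_mat (if j < length css then 1 else d) (if j < length css then 1 else d)"
    using ij chars[of "css ! j" i] r[of i] by (auto simp: nth_append mat_of_rows_list_def less_Suc_eq)
  show "transpose_mat (((map char_rep css @ [r]) ! j) (generator m R i)) *
      (if j < length css then mat_of_rows_list 1 [[1]] else J) *
      ((map char_rep css @ [r]) ! j) (generator m R i) =
      (if j < length css then mat_of_rows_list 1 [[1]] else J)"
  proof (cases "j < length css")
    case True
    then show ?thesis
      using ij chars[of "css ! j" i] signs[of "css ! j" i]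
      by (simp add: nth_append tr mult_mat_1x1 del: One_nat_def)
  next
    case False
    then show ?thesis using ij inv by (simp add: nth_append less_Suc_eq)
  qed
qed (use J in \<open>auto simp: mat_of_rows_list_def det_single\<close>)

lemma D4_has_form:
  fixes scale :: "'a::field \<Rightarrow> 'v::ab_group_add \<Rightarrow> 'v"
  assumes "representation_of_degree n D4 scale \<rho>" "is_direct_sum n D4 scale \<rho> k D4_irreps"
  shows "has_nondegenerate_invariant_form D4 scale \<rho>"
proof -
  let ?css = "[[1, 1], [1, -1], [-1, -1], [-1, 1]] :: 'a list list"
  let ?As = "[mat_of_rows_list 2 [[0, -1], [1, 0]], mat_of_rows_list 2 [[1, 0], [0, -1]]] :: 'a mat list"
  let ?R = "{([(0, True), (0, True), (0, True), (0, True)], []), ([(1, True), (1, True)], []),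
    ([(1, True), (0, True)], [(0, True), (0, True), (0, True), (1, True)])} :: (word \<times> word) set"
  have irreps: "D4_irreps = map char_rep ?css @ [mat_rep 2 ?As]" by (simp add: D4_irreps_def)
  have gen: "mat_rep 2 ?As (generator 2 ?R i) = ?As ! i" if "i < 2" for i
  proof (rule mat_rep_generator[OF that])
    fix i :: nat assume "i < 2"
    then show "?As ! i \<in> carrier_mat 2 2" "det (?As ! i) \<noteq> 0"
      by (auto dest!: less_2_cases simp: mat_2x2_carrier det_mat_2x2)
  next
    fix u v assume "(u, v) \<in> ?R"
    then show "word_value (GL_mat 2) ((!) ?As) u = word_value (GL_mat 2) ((!) ?As) v"
      by (auto simp: word_value_def GL_mat_simps one_mat_2x2 mult_mat_2x2)
  qed
  show ?thesis
    using assms unfolding irreps D4_def Let_def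
  proof (rule has_form_of_signs_and_2x2)
    fix c :: "'a list" and i :: nat assume c: "c \<in> set ?css" and i: "i < 2"
    show "char_rep c (generator 2 ?R i) = mat_of_rows_list 1 [[c ! i]]"
      by (rule char_rep_generator) (use c i in auto)
    show "c ! i * c ! i = 1" using c i by (auto dest!: less_2_cases)
  next
    fix i :: nat assume i: "i < 2"
    show "mat_rep 2 ?As (generator 2 ?R i) \<in> carrier_mat 2 2"
      unfolding gen[OF i] using i by (auto dest!: less_2_cases simp: mat_2x2_carrier)
    \<comment> \<open>The quarter turn and the reflection preserve the standard scalar product, so
      the identity matrix is the form.\<close>
    show "transpose_mat (mat_rep 2 ?As (generator 2 ?R i)) * mat_of_rows_list 2 [[1, 0], [0, 1]] *
        mat_rep 2 ?As (generator 2 ?R i) = mat_of_rows_list 2 [[1, 0], [0, 1]]"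
      unfolding gen[OF i] using i by (auto dest!: less_2_cases simp: mult_mat_2x2 transpose_mat_2x2)
  qed (simp_all add: mat_2x2_carrier det_mat_2x2)
qed

lemma Q8_has_form:
  fixes scale :: "'a::field \<Rightarrow> 'v::ab_group_add \<Rightarrow> 'v"
  assumes prim: "primitive_root_of_unity 8 \<omega>"
    and "representation_of_degree n Q8 scale \<rho>" "is_direct_sum n Q8 scale \<rho> k (Q8_irreps \<omega>)"
  shows "has_nondegenerate_invariant_form Q8 scale \<rho>"
proof -
  let ?css = "[[1, 1], [1, -1], [-1, -1], [-1, 1]] :: 'a list list"
  \<comment> \<open>A square root of -1; in these terms the generator \<open>a\<close> acts as the
    diagonal matrix with entries \<open>\<iota>\<close> and \<open>-\<iota>\<close>.\<close>
  define \<iota> where "\<iota> = \<omega>^2"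
  have \<omega>4: "\<omega> ^ 4 = -1" using primitive_root_half_power[of 4 \<omega>] prim by simp
  have \<iota>2: "\<iota> * \<iota> = -1" using \<omega>4 by (simp add: \<iota>_def flip: power_add)
  have \<omega>6: "\<omega> ^ 6 = -\<iota>" using power_add[of \<omega> 4 2] \<omega>4 by (simp add: \<iota>_def)
  have \<iota>0: "\<iota> \<noteq> 0" using \<iota>2 by auto
  let ?As = "[mat_of_rows_list 2 [[\<iota>, 0], [0, -\<iota>]], mat_of_rows_list 2 [[0, 1], [-1, 0]]]"
  let ?R = "{([(0, True), (0, True), (0, True), (0, True)], []), ([(0, True), (0, True)], [(1, True), (1, True)]),
    ([(1, True), (0, True)], [(0, True), (0, True), (0, True), (1, True)])} :: (word \<times> word) set"
  have irreps: "Q8_irreps \<omega> = map char_rep ?css @ [mat_rep 2 ?As]"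
    by (simp add: Q8_irreps_def \<omega>6 flip: \<iota>_def)
  have gen: "mat_rep 2 ?As (generator 2 ?R i) = ?As ! i" if "i < 2" for i
  proof (rule mat_rep_generator[OF that])
    fix i :: nat assume "i < 2"
    then show "?As ! i \<in> carrier_mat 2 2" "det (?As ! i) \<noteq> 0"
      using \<iota>0 by (auto dest!: less_2_cases simp: mat_2x2_carrier det_mat_2x2)
  next
    fix u v assume "(u, v) \<in> ?R"
    then show "word_value (GL_mat 2) ((!) ?As) u = word_value (GL_mat 2) ((!) ?As) v"
      by (auto simp: word_value_def GL_mat_simps one_mat_2x2 mult_mat_2x2 \<iota>2)
  qed
  show ?thesis
    using assms(2,3) unfolding irreps Q8_def Let_def
  proof (rule has_form_of_signs_and_2x2)
    fix c :: "'a list" and i :: nat assume c: "c \<in> set ?css" and i: "i < 2"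
    show "char_rep c (generator 2 ?R i) = mat_of_rows_list 1 [[c ! i]]"
      by (rule char_rep_generator) (use c i in auto)
    show "c ! i * c ! i = 1" using c i by (auto dest!: less_2_cases)
  next
    fix i :: nat assume i: "i < 2"
    show "mat_rep 2 ?As (generator 2 ?R i) \<in> carrier_mat 2 2"
      unfolding gen[OF i] using i by (auto dest!: less_2_cases simp: mat_2x2_carrier)
    \<comment> \<open>A 2 by 2 matrix scales the alternating form by its determinant, which is 1 for
      both generators.\<close>
    show "transpose_mat (mat_rep 2 ?As (generator 2 ?R i)) * mat_of_rows_list 2 [[0, 1], [-1, 0]] *
        mat_rep 2 ?As (generator 2 ?R i) = mat_of_rows_list 2 [[0, 1], [-1, 0]]"
      unfolding gen[OF i] using i by (auto dest!: less_2_cases simp: mult_mat_2x2 transpose_mat_2x2 \<iota>2)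
  qed (simp_all add: mat_2x2_carrier det_mat_2x2)
qed

theorem theorem1p3:
  fixes scale :: "'a::alg_closed_field \<Rightarrow> 'v::ab_group_add \<Rightarrow> 'v"
    and \<omega> :: 'a
    and n :: nat
  assumes "CHAR('a) \<noteq> 2"
    and "primitive_root_of_unity 8 \<omega>"
    and "n > 0"
  shows
    "(\<forall>\<rho> k. representation_of_degree n D4 scale \<rho> \<and> is_direct_sum n D4 scale \<rho> k D4_irreps \<longrightarrow>
        has_nondegenerate_invariant_form D4 scale \<rho>) \<and>
     (\<forall>\<rho> k. representation_of_degree n Q8 scale \<rho> \<and> is_direct_sum n Q8 scale \<rho> k (Q8_irreps \<omega>) \<longrightarrow>
        has_nondegenerate_invariant_form Q8 scale \<rho>) \<and>
     (\<forall>\<rho> k. representation_of_degree n Z8 scale \<rho> \<and> is_direct_sum n Z8 scale \<rho> k (Z8_irreps \<omega>) \<longrightarrow>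
        (has_nondegenerate_invariant_form Z8 scale \<rho> \<longleftrightarrow> k 3 = k 4 \<and> k 5 = k 6 \<and> k 7 = k 8)) \<and>
     (\<forall>\<rho> k. representation_of_degree n Z4xZ2 scale \<rho> \<and> is_direct_sum n Z4xZ2 scale \<rho> k (Z4xZ2_irreps \<omega>) \<longrightarrow>
        (has_nondegenerate_invariant_form Z4xZ2 scale \<rho> \<longleftrightarrow> k 5 = k 6 \<and> k 7 = k 8)) \<and>
     (\<forall>\<rho> k. representation_of_degree n Z2xZ2xZ2 scale \<rho> \<and> is_direct_sum n Z2xZ2xZ2 scale \<rho> k Z2xZ2xZ2_irreps \<longrightarrow>
        has_nondegenerate_invariant_form Z2xZ2xZ2 scale \<rho>)"
  using D4_has_form Q8_has_form[OF assms(2)] Z8_has_form_iff[OF assms(2)]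
    Z4xZ2_has_form_iff[OF assms(2)] Z2xZ2xZ2_has_form
  by blast

end
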